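(* Let $h>0$, $\Omega=\{(x_1,x_2)\in\mathbb{R}^2: 0<x_2<x_1<h\}$ (an isosceles right triangle) and $\Gamma=\{x_1=h,\ x_2\in[0,h]\}$ (a leg). Then the exact constant $C_1(\Omega,\Gamma)$ is equal to $\widetilde z_0^{-1}h$, where $\widetilde z_0\approx2.02876$ is the unique root of the equation $$z\cot(z)+1=0$$ in the interval $(0,\pi)$.
   Context: For a bounded connected Lipschitz domain $\Omega\subset\mathbb{R}^d$ and a measurable part $\Gamma\subset\partial\Omega$ of positive $(d-1)$-dimensional measure, let $\widetilde H^1(\Omega,\Gamma)=\{w\in H^1(\Omega): \text{the mean value of (the trace of) } w \text{ on } \Gamma \text{ is zero}\}$. The norm in $L^2(\omega)$ is denoted $\|\cdot\|_{2,\omega}$. The exact (sharp) constant $C_1(\Omega,\Gamma)$ is the smallest constant $C$ such that $\|w\|_{2,\Omega}\le C\|\nabla w\|_{2,\Omega}$ for all $w\in\widetilde H^1(\Omega,\Gamma)$. *)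

theory Defs
  imports "HOL-Analysis.Analysis"
begin

section \<open>Square-integrable functions\<close>

definition l2 :: "'a measure \<Rightarrow> ('a \<Rightarrow> 'b::euclidean_space) set" where
  "l2 M = {f. f \<in> borel_measurable M \<and> integrable M (\<lambda>x. (norm (f x))\<^sup>2)}"

definition l2_norm :: "'a measure \<Rightarrow> ('a \<Rightarrow> 'b::euclidean_space) \<Rightarrow> real" where
  "l2_norm M f = sqrt (LINT x|M. (norm (f x))\<^sup>2)"


section \<open>Surface measure\<close>

text \<open>
  Hausdorff measure of integer dimension \<open>s\<close>. Boundedness is demanded explicitly because
  \<^const>\<open>diameter\<close> is meaningless on unbounded sets; the case distinction only matters for
  \<open>s = 0\<close>, where \<open>0 ^ 0 = 1\<close> would count empty sets of a covering.
  The factor normalises the measure so that it is the usual \<open>s\<close>-dimensional area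
  (it is \<open>1\<close> for \<open>s = 1\<close>).
\<close>

definition hausdorff_pre :: "nat \<Rightarrow> real \<Rightarrow> 'a::metric_space set \<Rightarrow> ennreal" where
  "hausdorff_pre s \<delta> A =
     (INF U\<in>{U :: nat \<Rightarrow> 'a set. A \<subseteq> (\<Union>i. U i) \<and> (\<forall>i. bounded (U i) \<and> diameter (U i) \<le> \<delta>)}.
        \<Sum>i. if U i = {} then 0 else ennreal (diameter (U i) ^ s))"

definition hausdorff :: "nat \<Rightarrow> 'a::metric_space set \<Rightarrow> ennreal" where
  "hausdorff s A = ennreal (unit_ball_vol (real s) / 2 ^ s) * (SUP \<delta>\<in>{0<..}. hausdorff_pre s \<delta> A)"

definition surface_measure :: "'a::euclidean_space set \<Rightarrow> 'a measure" where
  "surface_measure \<Gamma> =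
     measure_of \<Gamma> (sets (restrict_space borel \<Gamma>)) (hausdorff (DIM('a) - 1))"

definition mean_value :: "'a measure \<Rightarrow> ('a \<Rightarrow> real) \<Rightarrow> real" where
  "mean_value M f = (LINT x|M. f x) / measure M (space M)"


section \<open>Smooth functions and weak gradients\<close>

primrec times_cont_diff :: "nat \<Rightarrow> ('a::euclidean_space \<Rightarrow> real) \<Rightarrow> bool" where
  "times_cont_diff 0 f \<longleftrightarrow> continuous_on UNIV f"
| "times_cont_diff (Suc k) f \<longleftrightarrow> (\<forall>x. f differentiable (at x)) \<and>
     (\<forall>b\<in>Basis. times_cont_diff k (\<lambda>x. frechet_derivative f (at x) b))"

definition smooth :: "('a::euclidean_space \<Rightarrow> real) \<Rightarrow> bool" where
  "smooth f \<longleftrightarrow> (\<forall>k. times_cont_diff k f)"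

definition test_function :: "'a::euclidean_space set \<Rightarrow> ('a \<Rightarrow> real) \<Rightarrow> bool" where
  "test_function \<Omega> \<phi> \<longleftrightarrow> smooth \<phi> \<and> (\<exists>K. compact K \<and> K \<subseteq> \<Omega> \<and> (\<forall>x. x \<notin> K \<longrightarrow> \<phi> x = 0))"

definition grad :: "('a::euclidean_space \<Rightarrow> real) \<Rightarrow> 'a \<Rightarrow> 'a" where
  "grad f x = (\<Sum>b\<in>Basis. frechet_derivative f (at x) b *\<^sub>R b)"

text \<open>
  \<open>h1 \<Omega> w dw\<close> says that \<open>w\<close> belongs to \<open>H\<^sup>1(\<Omega>)\<close> and that \<open>dw\<close> represents its weak gradient.
  As \<open>dw\<close> is determined by \<open>w\<close> up to a null set, the gradient is carried along as a second
  argument, in the style of \<^const>\<open>has_derivative\<close>.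
\<close>

definition h1 :: "'a::euclidean_space set \<Rightarrow> ('a \<Rightarrow> real) \<Rightarrow> ('a \<Rightarrow> 'a) \<Rightarrow> bool" where
  "h1 \<Omega> w dw \<longleftrightarrow> w \<in> l2 (lebesgue_on \<Omega>) \<and> dw \<in> l2 (lebesgue_on \<Omega>) \<and>
     (\<forall>\<phi>. test_function \<Omega> \<phi> \<longrightarrow>
        (LINT x|lebesgue_on \<Omega>. w x *\<^sub>R grad \<phi> x) = - (LINT x|lebesgue_on \<Omega>. \<phi> x *\<^sub>R dw x))"


section \<open>Traces and the exact constant\<close>

text \<open>
  The trace operator is the continuous extension to \<open>H\<^sup>1(\<Omega>)\<close> of the restriction map
  \<open>u \<mapsto> u|\<^bsub>\<Gamma>\<^esub>\<close>, defined on functions that are smooth up to the boundary. So \<open>\<tau>\<close> is the trace of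
  \<open>w\<close> if some sequence of smooth functions converges to \<open>w\<close> in \<open>H\<^sup>1(\<Omega>)\<close> while its restrictions
  converge to \<open>\<tau>\<close> in \<open>L\<^sup>2(\<Gamma>)\<close>. The memberships in \<^const>\<open>l2\<close> are automatic for bounded \<open>\<Omega>\<close> and
  \<open>\<Gamma>\<close> of finite measure; without them \<^const>\<open>l2_norm\<close> could be \<open>0\<close> for lack of integrability.
\<close>

definition has_trace ::
  "'a::euclidean_space set \<Rightarrow> 'a set \<Rightarrow> ('a \<Rightarrow> real) \<Rightarrow> ('a \<Rightarrow> 'a) \<Rightarrow> ('a \<Rightarrow> real) \<Rightarrow> bool" where
  "has_trace \<Omega> \<Gamma> w dw \<tau> \<longleftrightarrow> h1 \<Omega> w dw \<and> \<tau> \<in> l2 (surface_measure \<Gamma>) \<and>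
     (\<exists>u :: nat \<Rightarrow> 'a \<Rightarrow> real.
        (\<forall>n. smooth (u n) \<and> u n \<in> l2 (lebesgue_on \<Omega>) \<and> grad (u n) \<in> l2 (lebesgue_on \<Omega>) \<and>
             u n \<in> l2 (surface_measure \<Gamma>)) \<and>
        (\<lambda>n. l2_norm (lebesgue_on \<Omega>) (\<lambda>x. u n x - w x)) \<longlonglongrightarrow> 0 \<and>
        (\<lambda>n. l2_norm (lebesgue_on \<Omega>) (\<lambda>x. grad (u n) x - dw x)) \<longlonglongrightarrow> 0 \<and>
        (\<lambda>n. l2_norm (surface_measure \<Gamma>) (\<lambda>x. u n x - \<tau> x)) \<longlonglongrightarrow> 0)"

definition h1_mean_zero ::
  "'a::euclidean_space set \<Rightarrow> 'a set \<Rightarrow> ('a \<Rightarrow> real) \<Rightarrow> ('a \<Rightarrow> 'a) \<Rightarrow> bool" where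
  "h1_mean_zero \<Omega> \<Gamma> w dw \<longleftrightarrow>
     h1 \<Omega> w dw \<and> (\<exists>\<tau>. has_trace \<Omega> \<Gamma> w dw \<tau> \<and> mean_value (surface_measure \<Gamma>) \<tau> = 0)"

definition poincare_const :: "'a::euclidean_space set \<Rightarrow> 'a set \<Rightarrow> real \<Rightarrow> bool" where
  "poincare_const \<Omega> \<Gamma> C \<longleftrightarrow>
     (\<forall>w dw. h1_mean_zero \<Omega> \<Gamma> w dw \<longrightarrow>
        l2_norm (lebesgue_on \<Omega>) w \<le> C * l2_norm (lebesgue_on \<Omega>) dw)"

text \<open>
  The assertion \<open>C\<^sub>1(\<Omega>,\<Gamma>) = C\<close> as a relation, so that it includes the existence of a smallest
  constant.
\<close>

definition is_C1 :: "'a::euclidean_space set \<Rightarrow> 'a set \<Rightarrow> real \<Rightarrow> bool" where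
  "is_C1 \<Omega> \<Gamma> C \<longleftrightarrow> poincare_const \<Omega> \<Gamma> C \<and> (\<forall>C'. poincare_const \<Omega> \<Gamma> C' \<longrightarrow> C \<le> C')"

end

theory Submission
  imports Defs
begin

text \<open>
  Put \<open>k = z0 / h\<close>. Reflection in the hypotenuse turns a function \<open>u\<close> on the triangle into a symmetric
  function \<open>w (x, y) = u (max x y, min x y)\<close> on the square \<open>[0,h]\<^sup>2\<close>. By symmetry the Dirichlet integral
  of \<open>u\<close> over the triangle is the integral of \<open>v\<^sup>2\<close> over the square, where \<open>v\<close> is the derivative of \<open>w\<close> in
  its first variable, and the integral of \<open>u\<^sup>2\<close> is half of that of \<open>w\<^sup>2\<close>. So the claim becomes
  \<open>k\<^sup>2 / 2 * \<integral>\<integral> w\<^sup>2 \<le> \<integral>\<integral> v\<^sup>2\<close> for symmetric \<open>w\<close> with zero mean on the side \<open>x = h\<close>.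

  Average over \<open>y\<close>: let \<open>g x = 1/h * \<integral> w (x, y) dy\<close>, so that the boundary condition says just \<open>g h = 0\<close>.
  The remainder \<open>w - g x\<close> has, by symmetry, the mean \<open>g y - mean g\<close> on each horizontal line, and on these
  lines even a crude Poincare inequality is good enough, because \<open>z0\<^sup>2 / 2 \<approx> 2.06\<close> is far below \<open>\<pi>\<^sup>2\<close>.
  Everything is thus reduced to the nonlocal one-dimensional inequality
  \<open>k\<^sup>2 * (\<integral> g\<^sup>2 - (\<integral> g)\<^sup>2 / (2 h)) \<le> \<integral> g'\<^sup>2\<close> for \<open>g h = 0\<close>, in which the sharp constant sits. It is proved
  by integrating an explicit square: with \<open>s = k (h - x)\<close>, the integral of
  \<open>(g' + k cot s * g + \<lambda> tan (s/2))\<^sup>2\<close> can be evaluated by the fundamental theorem of calculus, and the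
  equation \<open>z0 cot z0 + 1 = 0\<close> is exactly what makes the boundary terms at \<open>x = 0\<close> fit together
  (\<open>nonlocal_interval_inequality\<close>, \<open>square_inequality\<close>, \<open>triangle_inequality\<close>).

  The trace is defined by approximation with smooth functions, so it is enough to treat those and to
  pass to the limit (\<open>poincare_upper\<close>). For this the mean value over the leg has to be an ordinary
  integral, that is, one-dimensional Hausdorff measure on a segment has to be Lebesgue measure
  (\<open>surface_measure_vertical\<close>). The constant is attained at \<open>cos (k x1) + cos (k x2)\<close>, whose mean on the
  leg vanishes by the same equation (\<open>poincare_sharp\<close>).

  The root \<open>z0\<close> is located by the strict monotonicity of \<open>sin z + z cos z\<close> on \<open>[\<pi>/2, \<pi>]\<close> and by two sign
  computations with Taylor polynomials (\<open>charfun_root\<close>).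
\<close>

section \<open>The characteristic equation\<close>

text \<open>
  The equation \<open>z cot z + 1 = 0\<close> multiplied by \<open>sin z\<close>, which removes the singularities.
\<close>
definition charfun :: "real \<Rightarrow> real" where
  "charfun z = sin z + z * cos z"

lemma charfun_iff:
  assumes "0 < z" "z < pi"
  shows "z * cot z + 1 = 0 \<longleftrightarrow> charfun z = 0"
proof -
  have "sin z > 0" using assms by (rule sin_gt_zero)
  then show ?thesis
    by (auto simp: charfun_def cot_def field_simps)
qed

lemma charfun_pos:
  assumes "0 < z" "z \<le> pi/2"
  shows "charfun z > 0"
proof -
  have "sin z > 0" using assms pi_gt_zero by (intro sin_gt_zero) linarith+
  moreover have "cos z \<ge> 0" using assms by (intro cos_ge_zero) linarith+
  ultimately show ?thesis using assms by (simp add: charfun_def add_pos_nonneg)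
qed

text \<open>
  The derivative is \<open>2 cos z - z sin z\<close>, and the cosine is not positive here.
\<close>
lemma charfun_strict_antimono:
  assumes "pi/2 \<le> a" "a < b" "b \<le> pi"
  shows "charfun b < charfun a"
proof (rule DERIV_neg_imp_decreasing_open[OF assms(2)])
  fix x assume x: "a < x" "x < b"
  have "(charfun has_real_derivative (2 * cos x - x * sin x)) (at x)"
    unfolding charfun_def[abs_def] by (auto intro!: derivative_eq_intros)
  moreover have "sin x > 0" using x assms pi_gt_zero by (intro sin_gt_zero) linarith+
  moreover have "cos x \<le> 0"
    using x assms cos_monotone_0_pi_le[of "pi/2" x] pi_gt_zero by auto
  moreover have "x > 0" using x assms pi_gt_zero by linarith
  ultimately have "2 * cos x - x * sin x < 0" using mult_pos_pos[of x "sin x"] by linarith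
  with \<open>(charfun has_real_derivative _) _\<close>
  show "\<exists>y. (charfun has_real_derivative y) (at x) \<and> y < 0" by blast
next
  show "continuous_on {a..b} charfun"
    unfolding charfun_def[abs_def] by (intro continuous_intros)
qed

lemma charfun_taylor:
  "\<bar>charfun z - ((\<Sum>m<n. sin_coeff m * z ^ m) + z * (\<Sum>m<n. cos_coeff m * z ^ m))\<bar>
     \<le> inverse (fact n) * \<bar>z\<bar> ^ n * (1 + \<bar>z\<bar>)"
proof -
  define S C e where "S = (\<Sum>m<n. sin_coeff m * z ^ m)" and "C = (\<Sum>m<n. cos_coeff m * z ^ m)"
    and "e = inverse (fact n) * \<bar>z\<bar> ^ n"
  have s: "\<bar>sin z - S\<bar> \<le> e" unfolding S_def e_def by (rule Maclaurin_sin_bound)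
  obtain t where t: "cos z = C + (cos (t + 1/2 * real n * pi) / fact n) * z ^ n"
    using Maclaurin_cos_expansion[of z n] unfolding C_def by blast
  then have "cos z - C = cos (t + 1/2 * real n * pi) * (inverse (fact n) * z ^ n)"
    by (simp only: divide_inverse mult.assoc add_diff_cancel_left')
  then have "\<bar>cos z - C\<bar> = \<bar>cos (t + 1/2 * real n * pi)\<bar> * e"
    by (simp only: abs_mult power_abs e_def abs_inverse abs_of_pos[OF fact_gt_zero])
  also have "\<dots> \<le> 1 * e" by (intro mult_right_mono abs_cos_le_one) (auto simp: e_def)
  finally have c: "\<bar>cos z - C\<bar> \<le> e" by simp
  have "charfun z - (S + z * C) = (sin z - S) + z * (cos z - C)"
    by (simp add: charfun_def algebra_simps)
  then have "\<bar>charfun z - (S + z * C)\<bar> \<le> \<bar>sin z - S\<bar> + \<bar>z\<bar> * \<bar>cos z - C\<bar>"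
    using abs_triangle_ineq[of "sin z - S" "z * (cos z - C)"] by (simp add: abs_mult)
  also have "\<dots> \<le> e + \<bar>z\<bar> * e" using s c by (intro add_mono mult_left_mono) auto
  finally show ?thesis by (simp add: algebra_simps S_def C_def e_def)
qed

text \<open>
  The Taylor polynomial of \<open>sin z + z cos z\<close> is \<open>z\<close> times a polynomial in \<open>z\<^sup>2\<close>. Evaluating at square
  roots of fractions with small denominators keeps the exact rational arithmetic cheap.
\<close>
lemma charfun_sqrt_approx:
  fixes x :: real
  assumes x: "4 \<le> x"
  defines "p \<equiv> 2 - 2/3 * x + x^2/20 - x^3/630 + x^4/36288 - x^5/3326400 + x^6/444787200"
  shows "\<bar>charfun (sqrt x) - sqrt x * p\<bar> \<le> sqrt x * (3/2 * (x ^ 7 / 87178291200))"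
proof -
  define z where "z = sqrt x"
  have z: "2 \<le> z" "z\<^sup>2 = x" using x by (auto simp: z_def real_le_rsqrt)
  have S: "(\<Sum>m<14. sin_coeff m * z ^ m) =
      z - z^3/6 + z^5/120 - z^7/5040 + z^9/362880 - z^11/39916800 + z^13/6227020800"
    by (simp add: sin_coeff_def lessThan_nat_numeral lessThan_Suc fact_numeral)
  have C: "(\<Sum>m<14. cos_coeff m * z ^ m) =
      1 - z^2/2 + z^4/24 - z^6/720 + z^8/40320 - z^10/3628800 + z^12/479001600"
    by (simp add: cos_coeff_def lessThan_nat_numeral lessThan_Suc fact_numeral)
  have "(\<Sum>m<14. sin_coeff m * z ^ m) + z * (\<Sum>m<14. cos_coeff m * z ^ m) = z * p"
    unfolding S C p_def z(2)[symmetric] by (simp add: field_simps eval_nat_numeral)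
  then have "\<bar>charfun z - z * p\<bar> \<le> inverse (fact 14) * \<bar>z\<bar> ^ 14 * (1 + \<bar>z\<bar>)"
    using charfun_taylor[of z 14] by simp
  also have "\<dots> = (z\<^sup>2) ^ 7 / 87178291200 * (1 + z)"
  proof -
    have "z ^ 14 = (z\<^sup>2) ^ 7" by (simp only: power_mult[symmetric]) simp
    moreover have "fact 14 = (87178291200 :: real)" by (simp add: fact_numeral)
    moreover have "\<bar>z\<bar> = z" using z by simp
    ultimately show ?thesis by (simp only: divide_inverse mult.commute)
  qed
  also have "\<dots> \<le> x ^ 7 / 87178291200 * (3/2 * z)"
    unfolding z(2) using z x by (intro mult_left_mono) auto
  finally show ?thesis by (simp add: z_def algebra_simps)
qed

lemma sign_from_approximation:
  fixes F s p e :: real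
  assumes "\<bar>F - s * p\<bar> \<le> s * e"
  shows "0 < s * (p - e) \<Longrightarrow> 0 < F" "s * (p + e) < 0 \<Longrightarrow> F < 0"
  using assms by (auto simp: algebra_simps abs_le_iff)

text \<open>
  The fractions \<open>675/164\<close> and \<open>959/233\<close> are chosen close to \<open>z0\<^sup>2 \<approx> 4.115858\<close>; their square roots lie on both sides
  of \<open>z0\<close>, within the required distance of \<open>2.02876\<close>.
\<close>
lemma charfun_lower: "charfun (sqrt (675/164)) > 0"
proof -
  let ?x = "675/164 :: real"
  let ?p = "2 - 2/3 * ?x + ?x^2/20 - ?x^3/630 + ?x^4/36288 - ?x^5/3326400 + ?x^6/444787200"
  have "0 < sqrt ?x * (?p - 3/2 * (?x ^ 7 / 87178291200))"
    by (intro mult_pos_pos) (simp_all add: power_divide)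
  then show ?thesis by (rule sign_from_approximation(1)[rotated]) (rule charfun_sqrt_approx, simp)
qed

lemma charfun_upper: "charfun (sqrt (959/233)) < 0"
proof -
  let ?x = "959/233 :: real"
  let ?p = "2 - 2/3 * ?x + ?x^2/20 - ?x^3/630 + ?x^4/36288 - ?x^5/3326400 + ?x^6/444787200"
  have "sqrt ?x * (?p + 3/2 * (?x ^ 7 / 87178291200)) < 0"
    by (intro mult_pos_neg) (simp_all add: power_divide)
  then show ?thesis by (rule sign_from_approximation(2)[rotated]) (rule charfun_sqrt_approx, simp)
qed

lemma charfun_root:
  "\<exists>z0. {z. 0 < z \<and> z < pi \<and> z * cot z + 1 = 0} = {z0} \<and> 2.028755 \<le> z0 \<and> z0 \<le> 2.028765"
proof -
  let ?a = "sqrt (675/164)" and ?b = "sqrt (959/233)"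
  have "continuous_on {?a..?b} charfun"
    unfolding charfun_def[abs_def] by (intro continuous_intros)
  then obtain z0 where ab: "?a \<le> z0" "z0 \<le> ?b" and r: "charfun z0 = 0"
    using IVT2'[of charfun ?b 0 ?a] charfun_lower charfun_upper by auto
  have "2.028755 \<le> ?a" by (intro real_le_rsqrt) (simp add: power2_eq_square)
  moreover have "?b \<le> 2.028765" by (intro real_le_lsqrt) (simp_all add: power2_eq_square)
  ultimately have z0: "2.028755 \<le> z0" "z0 \<le> 2.028765" "charfun z0 = 0" using ab r by linarith+
  have pi: "3 < pi" using pi_gt3 .
  have "z = z0" if "0 < z" "z < pi" "charfun z = 0" for z
  proof (rule ccontr)
    assume "z \<noteq> z0"
    have 1: "pi/2 < z" using charfun_pos[of z] that by force
    have 2: "pi/2 < z0" using charfun_pos[of z0] z0 by force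
    show False
      using \<open>z \<noteq> z0\<close> 1 2 charfun_strict_antimono[of z z0] charfun_strict_antimono[of z0 z] that z0 pi
      by (cases "z < z0") auto
  qed
  then have "{z. 0 < z \<and> z < pi \<and> z * cot z + 1 = 0} = {z0}"
    using z0 pi charfun_iff by auto
  then show ?thesis using z0 by blast
qed

section \<open>A nonlocal inequality on an interval\<close>

text \<open>
  The extremal function is \<open>cos (k x) - cos z\<close>. Picone's identity with the comparison function
  \<open>sin (k (h - x))\<close>, which is positive on \<open>[0,h)\<close> because \<open>z < \<pi>\<close>, leaves the boundary term \<open>g 0\<^sup>2 / h\<close> with
  the wrong sign. The additional term \<open>\<lambda> tan (k (h - x) / 2)\<close> in the square trades it for the integral of
  \<open>g\<close>: since \<open>2 cot s tan (s/2) = 1 - tan\<^sup>2 (s/2)\<close>, the cross terms integrate to \<open>\<integral> g\<close> and to \<open>g 0\<close>.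
  The equation for \<open>z\<close> enters twice, as \<open>k cot z = - 1/h\<close> and as \<open>2/k * T = h (T\<^sup>2 - 1)\<close> for
  \<open>T = tan (z/2)\<close>.
\<close>
lemma nonlocal_interval_inequality:
  fixes g g' :: "real \<Rightarrow> real" and z h :: real
  assumes h: "h > 0" and z: "0 < z" "z < pi" "z * cot z + 1 = 0"
    and dg: "\<And>x. x \<in> {0..h} \<Longrightarrow> (g has_real_derivative g' x) (at x within {0..h})"
    and cg': "continuous_on {0..h} g'" and gh: "g h = 0"
  shows "(z/h)\<^sup>2 * (integral {0..h} (\<lambda>x. (g x)\<^sup>2) - (integral {0..h} g)\<^sup>2 / (2*h))
     \<le> integral {0..h} (\<lambda>x. (g' x)\<^sup>2)"
proof -
  define k where "k = z/h"
  have k: "k > 0" "k * h = z" using h z by (auto simp: k_def)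
  define T where "T = tan (z/2)"
  have T: "T > 0" unfolding T_def using z by (intro tan_gt_zero) auto
  have cg: "continuous_on {0..h} g" using dg
    by (meson DERIV_continuous continuous_on_eq_continuous_within)
  define G where "G = integral {0..h} g"
  \<comment> \<open>the value for which the boundary terms at \<open>0\<close> collapse to \<open>- 2 h \<lambda>\<^sup>2\<close>\<close>
  define lam where "lam = g 0 / (h * T)"
  define s where "s = (\<lambda>x. k * (h - x))"
  \<comment> \<open>An antiderivative of \<open>R - g'\<^sup>2 + k\<^sup>2 g\<^sup>2 - 2 \<lambda> k g\<close>; as \<open>g h = 0\<close>, the singularity of the cotangent
    at \<open>x = h\<close> is removable and the value there is \<open>0\<close>.\<close>
  define P where "P = (\<lambda>x. (if x = h then 0 else k * cot (s x) * (g x)\<^sup>2)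
     + 2 * lam * (tan (s x / 2) * g x) + lam\<^sup>2 * (- (2/k) * tan (s x / 2) - x))"
  define R where "R = (\<lambda>x. (g' x + k * cot (s x) * g x + lam * tan (s x / 2))\<^sup>2)"
  have sx: "0 < s x" "s x \<le> z" if "0 \<le> x" "x < h" for x
    using that k h by (auto simp: s_def simp flip: k(2))
  have ints: "(\<lambda>x. (g x)\<^sup>2) integrable_on {0..h}" "(\<lambda>x. (g' x)\<^sup>2) integrable_on {0..h}"
     "g integrable_on {0..h}"
    by (intro integrable_continuous_interval continuous_intros cg cg')+
  have D: "(P has_vector_derivative
      (R x - (g' x)\<^sup>2 + k\<^sup>2 * (g x)\<^sup>2 - 2 * lam * k * g x)) (at x)" if x: "x \<in> {0<..<h}" for x
  proof -
    have s': "0 < s x" "s x < pi" using sx[of x] x z by auto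
    have sin: "sin (s x) > 0" using s' by (intro sin_gt_zero)
    have sin2: "sin (s x / 2) > 0" using s' by (intro sin_gt_zero) auto
    have cos2: "cos (s x / 2) > 0" using s' by (intro cos_gt_zero) auto
    have dgx: "(g has_real_derivative g' x) (at x)"
      using dg[of x] x at_within_Icc_at[of 0 x h] by auto
    define t where "t = tan (s x / 2)"
    define c where "c = cot (s x)"
    have sd: "(s has_real_derivative - k) (at x)"
      unfolding s_def by (auto intro!: derivative_eq_intros)
    have td: "((\<lambda>x. tan (s x / 2)) has_real_derivative - (k/2) * (1 + t\<^sup>2)) (at x)"
    proof -
      have "((\<lambda>x. tan (s x / 2)) has_real_derivative inverse ((cos (s x / 2))\<^sup>2) * (- k / 2)) (at x)"
        using DERIV_chain2[OF DERIV_tan DERIV_cdivide[OF sd, of 2]] cos2 by auto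
      moreover have "inverse ((cos (s x / 2))\<^sup>2) = 1 + t\<^sup>2"
        using cos2 sin_cos_squared_add[of "s x / 2"] by (simp add: t_def tan_def field_simps)
      ultimately show ?thesis by (simp add: algebra_simps)
    qed
    have cd: "((\<lambda>x. cot (s x)) has_real_derivative k * (1 + c\<^sup>2)) (at x)"
    proof -
      have "((\<lambda>x. cot (s x)) has_real_derivative - inverse ((sin (s x))\<^sup>2) * (- k)) (at x)"
        using DERIV_chain2[OF DERIV_cot sd] sin by auto
      moreover have "inverse ((sin (s x))\<^sup>2) = 1 + c\<^sup>2"
        using sin sin_cos_squared_add[of "s x"] by (simp add: c_def cot_def field_simps)
      ultimately show ?thesis by (simp add: algebra_simps)
    qed
    have ct: "2 * c * t = 1 - t\<^sup>2"
    proof -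
      have "sin (s x) = 2 * sin (s x/2) * cos (s x/2)" "cos (s x) = (cos (s x/2))\<^sup>2 - (sin (s x/2))\<^sup>2"
        using sin_double[of "s x/2"] cos_double[of "s x/2"] by auto
      then show ?thesis using sin2 cos2
        by (simp add: c_def t_def cot_def tan_def field_simps power2_eq_square)
    qed
    define P1 where "P1 = (\<lambda>x. k * cot (s x) * (g x)\<^sup>2
     + 2 * lam * (tan (s x / 2) * g x) + lam\<^sup>2 * (- (2/k) * tan (s x / 2) - x))"
    have Rx: "R x = (g' x + k * c * g x + lam * t)\<^sup>2" by (simp add: R_def c_def t_def)
    have "2 * (lam * k * g x) * (2 * c * t) = 2 * (lam * k * g x) * (1 - t\<^sup>2)" unfolding ct ..
    then have e: "4 * (lam * k * g x * c * t) = 2 * (lam * k * g x) - 2 * lam * k * g x * t\<^sup>2"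
      by (simp add: algebra_simps)
    have "(P1 has_real_derivative k * (k * (1 + c\<^sup>2)) * (g x)\<^sup>2 + k * c * (2 * g x * g' x)
        + 2 * lam * (- (k/2) * (1 + t\<^sup>2) * g x + t * g' x)
        + lam\<^sup>2 * (- (2/k) * (- (k/2) * (1 + t\<^sup>2)) - 1)) (at x)"
    proof -
      define tt cc where "tt = (\<lambda>x. tan (s x / 2))" and "cc = (\<lambda>x. cot (s x))"
      have [simp]: "tt x = t" "cc x = c" by (simp_all add: tt_def cc_def t_def c_def)
      have 1: "P1 = (\<lambda>x. k * cc x * (g x)\<^sup>2 + 2 * lam * (tt x * g x) + lam\<^sup>2 * (- (2/k) * tt x - x))"
        by (simp add: P1_def tt_def cc_def)
      note [derivative_intros] = td[folded tt_def] cd[folded cc_def] dgx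
      show ?thesis unfolding 1
        by (rule derivative_eq_intros refl)+ (use k in \<open>simp add: field_simps\<close>)
    qed
    also have "k * (k * (1 + c\<^sup>2)) * (g x)\<^sup>2 + k * c * (2 * g x * g' x)
        + 2 * lam * (- (k/2) * (1 + t\<^sup>2) * g x + t * g' x)
        + lam\<^sup>2 * (- (2/k) * (- (k/2) * (1 + t\<^sup>2)) - 1)
       = R x - (g' x)\<^sup>2 + k\<^sup>2 * (g x)\<^sup>2 - 2 * lam * k * g x"
      unfolding Rx using e k by (simp add: power2_eq_square field_simps)
    finally have "(P1 has_real_derivative (R x - (g' x)\<^sup>2 + k\<^sup>2 * (g x)\<^sup>2 - 2 * lam * k * g x)) (at x)" .
    moreover have "\<forall>\<^sub>F y in nhds x. P1 y = P y"
    proof (rule eventually_mono)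
      show "\<forall>\<^sub>F y in nhds x. y \<in> {0<..<h}" using x by (intro eventually_nhds_in_open) auto
    qed (auto simp: P1_def P_def)
    ultimately have "(P has_real_derivative (R x - (g' x)\<^sup>2 + k\<^sup>2 * (g x)\<^sup>2 - 2 * lam * k * g x)) (at x)"
      using DERIV_cong_ev[of x x P1 P] by blast
    then show ?thesis by (simp add: has_real_derivative_iff_has_vector_derivative)
  qed
  have cont: "continuous_on {0..h} P"
  proof -
    have 1: "continuous_on {0..h} (\<lambda>x. tan (s x / 2))"
      unfolding s_def
    proof (intro continuous_intros ballI)
      fix x assume "x \<in> {0..h}"
      then have "0 \<le> s x" "s x \<le> z" using sx[of x] h k by (auto simp: s_def)
      then have "cos (s x / 2) > 0" using z by (intro cos_gt_zero_pi) auto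
      then show "cos (k * (h - x) / 2) \<noteq> 0" by (simp add: s_def)
    qed simp
    have 2: "continuous_on {0..h} (\<lambda>x. if x = h then 0 else k * cot (s x) * (g x)\<^sup>2)"
      unfolding continuous_on_eq_continuous_within
    proof
      fix x assume x: "x \<in> {0..h}"
      show "continuous (at x within {0..h}) (\<lambda>x. if x = h then 0 else k * cot (s x) * (g x)\<^sup>2)"
      proof (cases "x = h")
        case False
        then have "sin (s x) > 0" using sx[of x] x z by (intro sin_gt_zero) auto
        moreover have "continuous (at x within {0..h}) g"
          using cg x continuous_on_eq_continuous_within by blast
        ultimately have "continuous (at x within {0..h}) (\<lambda>x. k * cot (s x) * (g x)\<^sup>2)"
          unfolding cot_def s_def by (intro continuous_intros) auto
        moreover have "\<forall>\<^sub>F y in at x within {0..h}. y \<noteq> h"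
          using tendsto_imp_eventually_ne[OF tendsto_ident_at False] .
        then have "\<forall>\<^sub>F y in at x within {0..h}. k * cot (s y) * (g y)\<^sup>2 = (if y = h then 0 else k * cot (s y) * (g y)\<^sup>2)"
          by (rule eventually_mono) simp
        ultimately show ?thesis
          unfolding continuous_within using False by (auto intro: Lim_transform_eventually)
      next
        case True
        have q: "((\<lambda>y. (g y - g h) / (y - h)) \<longlongrightarrow> g' h) (at h within {0..h})"
          using dg[of h] h by (simp add: has_field_derivative_iff)
        have 0: "(s \<longlongrightarrow> 0) (at h within {0..h})"
          unfolding s_def by (rule tendsto_eq_intros refl | simp)+
        have r: "((\<lambda>y. sin (s y) / s y) \<longlongrightarrow> 1) (at h within {0..h})"
        proof -
          have "filterlim s (at 0) (at h within {0..h})"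
            unfolding filterlim_at using 0 k by (auto simp: s_def eventually_at_filter)
          moreover have "((\<lambda>x. sin x / x) \<longlongrightarrow> 1) (at (0::real))"
            using DERIV_sin[of 0] by (simp add: DERIV_def)
          ultimately show ?thesis by (rule filterlim_compose[rotated])
        qed
        \<comment> \<open>the product of \<open>- s y cot (s y)\<close>, a difference quotient of \<open>g\<close> at \<open>h\<close>, and \<open>g y\<close>, which tends to \<open>0\<close>\<close>
        have "((\<lambda>y. - cos (s y) / (sin (s y) / s y) * ((g y - g h) / (y - h)) * g y) \<longlongrightarrow> - cos 0 / 1 * g' h * g h)
           (at h within {0..h})"
          using cg h unfolding continuous_on_def by (intro tendsto_intros 0 q r) auto
        then have "((\<lambda>y. - cos (s y) / (sin (s y) / s y) * ((g y - g h) / (y - h)) * g y) \<longlongrightarrow> 0) (at h within {0..h})"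
          by (simp add: gh)
        moreover have "\<forall>\<^sub>F y in at h within {0..h}. - cos (s y) / (sin (s y) / s y) * ((g y - g h) / (y - h)) * g y
             = (if y = h then 0 else k * cot (s y) * (g y)\<^sup>2)"
        proof -
          have "- cos (s y) / (sin (s y) / s y) * ((g y - g h) / (y - h)) * g y
             = (if y = h then 0 else k * cot (s y) * (g y)\<^sup>2)" if "y \<noteq> h" for y
          proof -
            have "s y / (y - h) = - k" using that by (simp add: s_def field_simps)
            then have "- cos (s y) / sin (s y) * (s y / (y - h)) * (g y)\<^sup>2 = k * cot (s y) * (g y)\<^sup>2"
              by (simp add: cot_def)
            then show ?thesis using that by (simp add: gh power2_eq_square)
          qed
          then show ?thesis by (auto simp: eventually_at_filter)
        qed
        ultimately show ?thesis unfolding True continuous_within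
          by (auto intro: Lim_transform_eventually)
      qed
    qed
    show ?thesis unfolding P_def
      by (intro 1 2 cg continuous_on_add continuous_on_mult continuous_on_diff continuous_on_const continuous_on_id)
  qed
  have I: "((\<lambda>x. R x - (g' x)\<^sup>2 + k\<^sup>2 * (g x)\<^sup>2 - 2 * lam * k * g x) has_integral (P h - P 0)) {0..h}"
    using h by (intro fundamental_theorem_of_calculus_interior cont D) auto
  have J: "((\<lambda>x. (g' x)\<^sup>2 - k\<^sup>2 * (g x)\<^sup>2 + 2 * lam * k * g x) has_integral
      (integral {0..h} (\<lambda>x. (g' x)\<^sup>2) - k\<^sup>2 * integral {0..h} (\<lambda>x. (g x)\<^sup>2) + 2 * lam * k * G)) {0..h}"
    unfolding G_def using ints
    by (intro has_integral_add has_integral_diff has_integral_mult_right integrable_integral)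
  have "(R has_integral (P h - P 0 + (integral {0..h} (\<lambda>x. (g' x)\<^sup>2) - k\<^sup>2 * integral {0..h} (\<lambda>x. (g x)\<^sup>2) + 2 * lam * k * G))) {0..h}"
    using has_integral_add[OF I J] by (simp add: algebra_simps)
  then have nn: "0 \<le> P h - P 0 + (integral {0..h} (\<lambda>x. (g' x)\<^sup>2) - k\<^sup>2 * integral {0..h} (\<lambda>x. (g x)\<^sup>2) + 2 * lam * k * G)"
    by (rule has_integral_nonneg) (auto simp: R_def)
  have g0: "g 0 = lam * h * T" using h T by (simp add: lam_def)
  have kc: "k * cot z = - 1 / h" using z h by (simp add: k_def field_simps)
  have TT: "2 / k * T = h * (T\<^sup>2 - 1)"
  proof -
    have "sin (z/2) > 0" "cos (z/2) > 0" using z by (auto intro!: sin_gt_zero cos_gt_zero)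
    moreover have "sin z = 2 * sin (z/2) * cos (z/2)" "cos z = (cos (z/2))\<^sup>2 - (sin (z/2))\<^sup>2"
        using sin_double[of "z/2"] cos_double[of "z/2"] by auto
    ultimately have "2 * cot z * T = 1 - T\<^sup>2"
      by (simp add: T_def cot_def tan_def field_simps power2_eq_square)
    moreover have "cot z = - 1 / z" using z by (simp add: field_simps)
    ultimately have "2 * T / z = T\<^sup>2 - 1" by simp
    then have "h * (2 * T / z) = h * (T\<^sup>2 - 1)" by (simp only:)
    then show ?thesis by (simp add: k_def mult_ac)
  qed
  have "P h = - lam\<^sup>2 * h" using h by (simp add: P_def s_def gh)
  moreover have "P 0 = - 1/h * (lam * h * T)\<^sup>2 + 2 * lam * (T * (lam * h * T)) + lam\<^sup>2 * (- (h * (T\<^sup>2 - 1)))"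
    using h unfolding P_def s_def by (simp add: k(2) kc g0 T_def[symmetric] TT[symmetric])
  moreover have "- 1/h * (lam * h * T)\<^sup>2 = - (lam\<^sup>2 * h * T\<^sup>2)"
    using h by (simp add: power2_eq_square field_simps)
  ultimately have "P h - P 0 = - 2 * h * lam\<^sup>2" using h by (simp add: algebra_simps power2_eq_square)
  moreover have "- 2 * h * lam\<^sup>2 + 2 * lam * k * G \<le> k\<^sup>2 * G\<^sup>2 / (2 * h)"
  proof -
    have "0 \<le> 2 * h * (lam - k * G / (2*h))\<^sup>2" using h by simp
    also have "\<dots> = 2 * h * lam\<^sup>2 - 2 * lam * k * G + k\<^sup>2 * G\<^sup>2 / (2 * h)"
      using h by (simp add: power2_eq_square field_simps)
    finally show ?thesis by simp
  qed
  ultimately show ?thesis using nn by (simp add: k_def[symmetric] G_def[symmetric] algebra_simps)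
qed

section \<open>Square-integrable functions\<close>

text \<open>
  The discriminant argument, for the integral of \<open>(t f - g)\<^sup>2\<close> as a quadratic polynomial in \<open>t\<close>.
\<close>
lemma Cauchy_Schwarz_integral:
  fixes f g :: "'a \<Rightarrow> real"
  assumes [measurable]: "f \<in> borel_measurable M" "g \<in> borel_measurable M"
    and f2: "integrable M (\<lambda>x. (f x)\<^sup>2)" and g2: "integrable M (\<lambda>x. (g x)\<^sup>2)"
  shows "integrable M (\<lambda>x. f x * g x)"
    and "(LINT x|M. f x * g x)\<^sup>2 \<le> (LINT x|M. (f x)\<^sup>2) * (LINT x|M. (g x)\<^sup>2)"
proof -
  show fg: "integrable M (\<lambda>x. f x * g x)"
  proof (rule Bochner_Integration.integrable_bound[OF Bochner_Integration.integrable_add[OF f2 g2]])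
    have "\<bar>a * b\<bar> \<le> \<bar>a\<^sup>2 + b\<^sup>2\<bar>" for a b :: real
    proof -
      have "2 * (\<bar>a\<bar> * \<bar>b\<bar>) \<le> a\<^sup>2 + b\<^sup>2"
        using sum_squares_bound[of "\<bar>a\<bar>" "\<bar>b\<bar>"] by simp
      moreover have "0 \<le> \<bar>a\<bar> * \<bar>b\<bar>" by simp
      ultimately show ?thesis unfolding abs_mult by linarith
    qed
    then show "AE x in M. norm (f x * g x) \<le> norm ((f x)\<^sup>2 + (g x)\<^sup>2)" by simp
  qed measurable
  define A B C where "A = (LINT x|M. (f x)\<^sup>2)" and "B = (LINT x|M. f x * g x)" and "C = (LINT x|M. (g x)\<^sup>2)"
  have quad: "0 \<le> A * t\<^sup>2 - 2 * B * t + C" for t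
  proof -
    have "0 \<le> (LINT x|M. (t * f x - g x)\<^sup>2)" by simp
    also have "\<dots> = (LINT x|M. t\<^sup>2 * (f x)\<^sup>2 - 2 * t * (f x * g x) + (g x)\<^sup>2)"
      by (intro Bochner_Integration.integral_cong) (auto simp: power2_eq_square algebra_simps)
    also have "\<dots> = t\<^sup>2 * A - 2 * t * B + C"
      unfolding A_def B_def C_def using f2 g2 fg by simp
    finally show ?thesis by (simp add: algebra_simps)
  qed
  have "A \<ge> 0" unfolding A_def by simp
  show "B\<^sup>2 \<le> A * C"
  proof (cases "A = 0")
    case True
    have "B = 0"
    proof (rule ccontr)
      assume "B \<noteq> 0"
      then show False using quad[of "(C + 1) / (2 * B)"] True by (simp add: field_simps)
    qed
    then show ?thesis using True by simp
  next
    case False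
    with \<open>A \<ge> 0\<close> have "A > 0" by simp
    then have "A * (B/A)\<^sup>2 - 2 * B * (B/A) + C = C - B\<^sup>2 / A"
      by (simp add: power2_eq_square field_simps)
    then have "B\<^sup>2 / A \<le> C" using quad[of "B/A"] by simp
    then show ?thesis using \<open>A > 0\<close> by (simp add: field_simps)
  qed
qed

text \<open>
  Minkowski's inequality, from the Cauchy-Schwarz inequality for the norms.
\<close>
lemma l2_add:
  fixes f g :: "'a \<Rightarrow> 'b::euclidean_space"
  assumes f: "f \<in> l2 M" and g: "g \<in> l2 M"
  shows "(\<lambda>x. f x + g x) \<in> l2 M" and "l2_norm M (\<lambda>x. f x + g x) \<le> l2_norm M f + l2_norm M g"
proof -
  have fm[measurable]: "f \<in> borel_measurable M" and gm[measurable]: "g \<in> borel_measurable M"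
    and fi: "integrable M (\<lambda>x. (norm (f x))\<^sup>2)" and gi: "integrable M (\<lambda>x. (norm (g x))\<^sup>2)"
    using f g by (auto simp: l2_def)
  have cs: "integrable M (\<lambda>x. norm (f x) * norm (g x))"
    "(LINT x|M. norm (f x) * norm (g x))\<^sup>2 \<le> (LINT x|M. (norm (f x))\<^sup>2) * (LINT x|M. (norm (g x))\<^sup>2)"
    using Cauchy_Schwarz_integral[OF _ _ fi gi] by measurable
  let ?b = "\<lambda>x. (norm (f x))\<^sup>2 + 2 * (norm (f x) * norm (g x)) + (norm (g x))\<^sup>2"
  have bi: "integrable M ?b" using fi gi cs(1) by simp
  have le: "(norm (f x + g x))\<^sup>2 \<le> ?b x" for x
  proof -
    have "(norm (f x + g x))\<^sup>2 \<le> (norm (f x) + norm (g x))\<^sup>2" by (intro power_mono norm_triangle_ineq) simp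
    then show ?thesis by (simp add: power2_sum)
  qed
  have i: "integrable M (\<lambda>x. (norm (f x + g x))\<^sup>2)"
  proof (rule Bochner_Integration.integrable_bound[OF bi])
    show "AE x in M. norm ((norm (f x + g x))\<^sup>2) \<le> norm (?b x)" using le by (intro AE_I2) (smt (verit) norm_ge_zero real_norm_def zero_le_power2)
  qed measurable
  then show "(\<lambda>x. f x + g x) \<in> l2 M" by (auto simp: l2_def)
  define A B where "A = (LINT x|M. (norm (f x))\<^sup>2)" and "B = (LINT x|M. (norm (g x))\<^sup>2)"
  have AB: "A \<ge> 0" "B \<ge> 0" by (simp_all add: A_def B_def)
  have "(LINT x|M. (norm (f x + g x))\<^sup>2) \<le> (LINT x|M. ?b x)" by (intro integral_mono i bi le)
  also have "\<dots> = A + 2 * (LINT x|M. norm (f x) * norm (g x)) + B"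
    using fi gi cs(1) by (simp add: A_def B_def)
  also have "(LINT x|M. norm (f x) * norm (g x)) \<le> sqrt A * sqrt B"
    using real_le_rsqrt[OF cs(2)] by (simp add: A_def B_def real_sqrt_mult)
  also have "A + 2 * (sqrt A * sqrt B) + B = (sqrt A + sqrt B)\<^sup>2" using AB by (simp add: power2_sum)
  finally have "sqrt (LINT x|M. (norm (f x + g x))\<^sup>2) \<le> sqrt A + sqrt B"
    using AB by (intro real_le_lsqrt) auto
  then show "l2_norm M (\<lambda>x. f x + g x) \<le> l2_norm M f + l2_norm M g"
    by (simp add: l2_norm_def A_def B_def)
qed

lemma l2_minus: "f \<in> l2 M \<Longrightarrow> (\<lambda>x. - f x) \<in> l2 M" by (auto simp: l2_def)

lemma l2_diff: "f \<in> l2 M \<Longrightarrow> g \<in> l2 M \<Longrightarrow> (\<lambda>x. f x - g x) \<in> l2 M"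
  using l2_add(1)[of f M "\<lambda>x. - g x"] l2_minus[of g M] by simp

lemma l2_norm_commute: "l2_norm M (\<lambda>x. f x - g x) = l2_norm M (\<lambda>x. g x - f x)"
  by (simp add: l2_norm_def norm_minus_commute)

lemma l2_integral_le:
  fixes f :: "'a \<Rightarrow> real"
  assumes M: "finite_measure M" and f: "f \<in> l2 M"
  shows "integrable M f" "\<bar>LINT x|M. f x\<bar> \<le> sqrt (measure M (space M)) * l2_norm M f"
proof -
  interpret finite_measure M by (rule M)
  have fm: "f \<in> borel_measurable M" and fi: "integrable M (\<lambda>x. (f x)\<^sup>2)"
    using f by (auto simp: l2_def)
  note cs = Cauchy_Schwarz_integral[of "\<lambda>_. 1" M f, OF _ fm _ fi]
  show "integrable M f" using cs(1) by simp
  have "(LINT x|M. f x)\<^sup>2 \<le> measure M (space M) * (LINT x|M. (f x)\<^sup>2)" using cs(2) by simp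
  then have "\<bar>LINT x|M. f x\<bar> \<le> sqrt (measure M (space M) * (LINT x|M. (f x)\<^sup>2))"
    by (intro real_le_rsqrt) simp
  then show "\<bar>LINT x|M. f x\<bar> \<le> sqrt (measure M (space M)) * l2_norm M f"
    by (simp add: l2_norm_def real_sqrt_mult)
qed


section \<open>Iterated integrals of bounded Borel functions over a square\<close>

text \<open>
  The open interval is used so that the square of this measure lives on \<open>(0,h)\<^sup>2\<close>, of which the
  triangle is exactly the part below the diagonal.
\<close>
definition ival :: "real \<Rightarrow> real measure" where
  "ival h = restrict_space lborel {0<..<h}"

lemma space_ival [simp]: "space (ival h) = {0<..<h}"
  by (simp add: ival_def space_restrict_space)

lemma finite_measure_ival: "finite_measure (ival h)"
proof (rule finite_measureI)
  have "emeasure (ival h) {0<..<h} = emeasure lborel {0<..<h}"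
    unfolding ival_def by (intro emeasure_restrict_space) auto
  then show "emeasure (ival h) (space (ival h)) \<noteq> \<infinity>" by (cases "0 \<le> h") auto
qed

interpretation ival: finite_measure "ival h" for h by (rule finite_measure_ival)
interpretation ival2: pair_sigma_finite "ival h" "ival h" for h ..

lemma measure_ival [simp]: "0 \<le> h \<Longrightarrow> measure (ival h) {0<..<h} = h"
  unfolding ival_def by (subst measure_restrict_space) auto

lemma borel_ival: "f \<in> borel_measurable borel \<Longrightarrow> f \<in> borel_measurable (ival h)"
  unfolding ival_def by (intro measurable_restrict_space1) simp

text \<open>
  Borel functions that are bounded on \<open>[0,h]\<close>, and their analogue on \<open>[0,h]\<^sup>2\<close>: a class that is closed
  under the algebraic operations, sections and partial integration, contains the discontinuous
  derivatives which arise by reflection, and consists of integrable functions.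
\<close>
definition bounded_borel :: "real \<Rightarrow> (real \<Rightarrow> real) \<Rightarrow> bool" where
  "bounded_borel h f \<longleftrightarrow> f \<in> borel_measurable borel \<and> (\<exists>B. \<forall>x\<in>{0..h}. \<bar>f x\<bar> \<le> B)"

definition bounded_borel2 :: "real \<Rightarrow> (real \<Rightarrow> real \<Rightarrow> real) \<Rightarrow> bool" where
  "bounded_borel2 h F \<longleftrightarrow> case_prod F \<in> borel_measurable borel \<and> (\<exists>B. \<forall>x\<in>{0..h}. \<forall>y\<in>{0..h}. \<bar>F x y\<bar> \<le> B)"

lemma bounded_borelI: "f \<in> borel_measurable borel \<Longrightarrow> (\<And>x. x \<in> {0..h} \<Longrightarrow> \<bar>f x\<bar> \<le> B) \<Longrightarrow> bounded_borel h f"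
  unfolding bounded_borel_def by blast

lemma bounded_borelE:
  assumes "bounded_borel h f"
  obtains B where "f \<in> borel_measurable borel" "\<And>x. x \<in> {0..h} \<Longrightarrow> \<bar>f x\<bar> \<le> B"
  using assms unfolding bounded_borel_def by blast

lemma bounded_borel_borel: "bounded_borel h f \<Longrightarrow> f \<in> borel_measurable borel"
  unfolding bounded_borel_def by blast

lemma bounded_borel_ival: "bounded_borel h f \<Longrightarrow> f \<in> borel_measurable (ival h)"
  by (intro borel_ival bounded_borel_borel)

lemma bounded_borel2I:
  "case_prod F \<in> borel_measurable borel \<Longrightarrow>
   (\<And>x y. x \<in> {0..h} \<Longrightarrow> y \<in> {0..h} \<Longrightarrow> \<bar>F x y\<bar> \<le> B) \<Longrightarrow> bounded_borel2 h F"
  unfolding bounded_borel2_def by blast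

lemma bounded_borel2E:
  assumes "bounded_borel2 h F"
  obtains B where "case_prod F \<in> borel_measurable borel"
    "\<And>x y. x \<in> {0..h} \<Longrightarrow> y \<in> {0..h} \<Longrightarrow> \<bar>F x y\<bar> \<le> B"
  using assms unfolding bounded_borel2_def by blast

lemma bounded_borel2_measurable:
  assumes "bounded_borel2 h F"
  shows "case_prod F \<in> borel_measurable (borel \<Otimes>\<^sub>M borel)"
  using assms unfolding bounded_borel2_def borel_prod by blast

lemma bounded_borel_const: "bounded_borel h (\<lambda>x. c)" by (rule bounded_borelI[of _ _ "\<bar>c\<bar>"]) auto

lemma bounded_borel_cont:
  assumes c: "continuous_on UNIV f" shows "bounded_borel h f"
proof -
  have "bounded (f ` {0..h})"
    by (rule compact_imp_bounded[OF compact_continuous_image[OF continuous_on_subset[OF c]]]) auto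
  then obtain B where "\<forall>x\<in>f ` {0..h}. norm x \<le> B" unfolding bounded_iff by blast
  then show ?thesis by (intro bounded_borelI[of f h B] borel_measurable_continuous_onI[OF c]) simp
qed

lemma bounded_borel_add: assumes "bounded_borel h f" "bounded_borel h g" shows "bounded_borel h (\<lambda>x. f x + g x)"
proof -
  obtain B where f: "f \<in> borel_measurable borel" "\<And>x. x \<in> {0..h} \<Longrightarrow> \<bar>f x\<bar> \<le> B" using assms(1) by (rule bounded_borelE) blast
  obtain C where g: "g \<in> borel_measurable borel" "\<And>x. x \<in> {0..h} \<Longrightarrow> \<bar>g x\<bar> \<le> C" using assms(2) by (rule bounded_borelE) blast
  show ?thesis
  proof (rule bounded_borelI)
    show "\<bar>f x + g x\<bar> \<le> B + C" if "x \<in> {0..h}" for x using f(2)[OF that] g(2)[OF that] by linarith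
  qed (intro borel_measurable_add f g)
qed

lemma bounded_borel_mult: assumes "bounded_borel h f" "bounded_borel h g" shows "bounded_borel h (\<lambda>x. f x * g x)"
proof -
  obtain B where f: "f \<in> borel_measurable borel" "\<And>x. x \<in> {0..h} \<Longrightarrow> \<bar>f x\<bar> \<le> B" using assms(1) by (rule bounded_borelE) blast
  obtain C where g: "g \<in> borel_measurable borel" "\<And>x. x \<in> {0..h} \<Longrightarrow> \<bar>g x\<bar> \<le> C" using assms(2) by (rule bounded_borelE) blast
  show ?thesis
  proof (rule bounded_borelI)
    show "\<bar>f x * g x\<bar> \<le> B * C" if "x \<in> {0..h}" for x
      unfolding abs_mult using f(2)[OF that] g(2)[OF that] by (intro mult_mono) auto
  qed (intro borel_measurable_times f g)
qed

lemma bounded_borel_diff: assumes "bounded_borel h f" "bounded_borel h g" shows "bounded_borel h (\<lambda>x. f x - g x)"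
proof -
  have "bounded_borel h (\<lambda>x. f x + (-1) * g x)" by (intro bounded_borel_add bounded_borel_mult bounded_borel_const assms)
  then show ?thesis by simp
qed

lemma bounded_borel_power2: assumes "bounded_borel h f" shows "bounded_borel h (\<lambda>x. (f x)\<^sup>2)"
  unfolding power2_eq_square by (intro bounded_borel_mult assms)

lemma bounded_borel2_fst: assumes "bounded_borel h f" shows "bounded_borel2 h (\<lambda>x y. f x)"
proof -
  obtain B where f: "f \<in> borel_measurable borel" "\<And>x. x \<in> {0..h} \<Longrightarrow> \<bar>f x\<bar> \<le> B" using assms by (rule bounded_borelE) blast
  show ?thesis
    using measurable_compose[OF measurable_fst f(1)] f(2)
    by (intro bounded_borel2I[of _ _ B]) (simp_all add: case_prod_unfold borel_prod[symmetric])
qed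

lemma bounded_borel2_snd: assumes "bounded_borel h f" shows "bounded_borel2 h (\<lambda>x y. f y)"
proof -
  obtain B where f: "f \<in> borel_measurable borel" "\<And>x. x \<in> {0..h} \<Longrightarrow> \<bar>f x\<bar> \<le> B" using assms by (rule bounded_borelE) blast
  show ?thesis
    using measurable_compose[OF measurable_snd f(1)] f(2)
    by (intro bounded_borel2I[of _ _ B]) (simp_all add: case_prod_unfold borel_prod[symmetric])
qed

lemma bounded_borel2_swap: assumes F: "bounded_borel2 h F" shows "bounded_borel2 h (\<lambda>x y. F y x)"
proof -
  obtain B where B: "\<And>x y. x \<in> {0..h} \<Longrightarrow> y \<in> {0..h} \<Longrightarrow> \<bar>F x y\<bar> \<le> B" using F by (rule bounded_borel2E) blast
  show ?thesis
  proof (rule bounded_borel2I)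
    show "(\<lambda>(x, y). F y x) \<in> borel_measurable borel"
      using measurable_pair_swap[OF bounded_borel2_measurable[OF F]] by (simp add: case_prod_unfold borel_prod)
  qed (rule B)
qed

lemma bounded_borel2_add: assumes "bounded_borel2 h F" "bounded_borel2 h G" shows "bounded_borel2 h (\<lambda>x y. F x y + G x y)"
proof -
  obtain B where f: "case_prod F \<in> borel_measurable borel"
    "\<And>x y. x \<in> {0..h} \<Longrightarrow> y \<in> {0..h} \<Longrightarrow> \<bar>F x y\<bar> \<le> B" using assms(1) by (rule bounded_borel2E) blast
  obtain C where g: "case_prod G \<in> borel_measurable borel"
    "\<And>x y. x \<in> {0..h} \<Longrightarrow> y \<in> {0..h} \<Longrightarrow> \<bar>G x y\<bar> \<le> C" using assms(2) by (rule bounded_borel2E) blast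
  show ?thesis
  proof (rule bounded_borel2I)
    show "\<bar>F x y + G x y\<bar> \<le> B + C" if "x \<in> {0..h}" "y \<in> {0..h}" for x y
      using f(2)[OF that] g(2)[OF that] by linarith
    show "(\<lambda>(x, y). F x y + G x y) \<in> borel_measurable borel"
      using borel_measurable_add[OF f(1) g(1)] by (simp add: case_prod_unfold)
  qed
qed

lemma bounded_borel2_mult: assumes "bounded_borel2 h F" "bounded_borel2 h G" shows "bounded_borel2 h (\<lambda>x y. F x y * G x y)"
proof -
  obtain B where f: "case_prod F \<in> borel_measurable borel"
    "\<And>x y. x \<in> {0..h} \<Longrightarrow> y \<in> {0..h} \<Longrightarrow> \<bar>F x y\<bar> \<le> B" using assms(1) by (rule bounded_borel2E) blast
  obtain C where g: "case_prod G \<in> borel_measurable borel"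
    "\<And>x y. x \<in> {0..h} \<Longrightarrow> y \<in> {0..h} \<Longrightarrow> \<bar>G x y\<bar> \<le> C" using assms(2) by (rule bounded_borel2E) blast
  show ?thesis
  proof (rule bounded_borel2I)
    show "\<bar>F x y * G x y\<bar> \<le> B * C" if "x \<in> {0..h}" "y \<in> {0..h}" for x y
      unfolding abs_mult using f(2)[OF that] g(2)[OF that] by (intro mult_mono) auto
    show "(\<lambda>(x, y). F x y * G x y) \<in> borel_measurable borel"
      using borel_measurable_times[OF f(1) g(1)] by (simp add: case_prod_unfold)
  qed
qed

lemma bounded_borel2_diff: assumes "bounded_borel2 h F" "bounded_borel2 h G" shows "bounded_borel2 h (\<lambda>x y. F x y - G x y)"
proof -
  have "bounded_borel2 h (\<lambda>x y. F x y + (-1) * G x y)" by (intro bounded_borel2_add bounded_borel2_mult bounded_borel2_fst bounded_borel_const assms)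
  then show ?thesis by simp
qed

lemma bounded_borel2_power2: assumes "bounded_borel2 h F" shows "bounded_borel2 h (\<lambda>x y. (F x y)\<^sup>2)"
  unfolding power2_eq_square by (intro bounded_borel2_mult assms)

lemma bounded_borel2_section1: assumes F: "bounded_borel2 h F" and x: "x \<in> {0..h}" shows "bounded_borel h (F x)"
proof -
  obtain B where B: "\<And>x y. x \<in> {0..h} \<Longrightarrow> y \<in> {0..h} \<Longrightarrow> \<bar>F x y\<bar> \<le> B" using F by (rule bounded_borel2E) blast
  have "F x \<in> borel_measurable borel"
    using measurable_Pair2[OF bounded_borel2_measurable[OF F], of x] by simp
  then show ?thesis using B[OF x] by (rule bounded_borelI)
qed

lemma bounded_borel2_section2: "bounded_borel2 h F \<Longrightarrow> y \<in> {0..h} \<Longrightarrow> bounded_borel h (\<lambda>x. F x y)"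
  using bounded_borel2_section1[OF bounded_borel2_swap] .

lemma bounded_borel_integrable: assumes "bounded_borel h f" shows "integrable (ival h) f"
proof -
  obtain B where f: "f \<in> borel_measurable borel" "\<And>x. x \<in> {0..h} \<Longrightarrow> \<bar>f x\<bar> \<le> B" using assms by (rule bounded_borelE) blast
  show ?thesis
  proof (rule ival.integrable_const_bound)
    show "AE x in ival h. norm (f x) \<le> B" using f(2) by (intro AE_I2) simp
  qed (intro borel_ival f)
qed

lemma pair_ival_borel:
  "(\<lambda>p. (fst p, snd p)) \<in> measurable (ival h \<Otimes>\<^sub>M ival h) (borel \<Otimes>\<^sub>M borel)"
  by (rule measurable_Pair[OF measurable_compose[OF measurable_fst borel_ival[OF measurable_ident]] 
       measurable_compose[OF measurable_snd borel_ival[OF measurable_ident]], unfolded id_def])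

lemma bounded_borel2_integrable: assumes F: "bounded_borel2 h F" shows "integrable (ival h \<Otimes>\<^sub>M ival h) (case_prod F)"
proof -
  obtain B where B: "\<And>x y. x \<in> {0..h} \<Longrightarrow> y \<in> {0..h} \<Longrightarrow> \<bar>F x y\<bar> \<le> B" using F by (rule bounded_borel2E) blast
  interpret P: finite_measure "ival h \<Otimes>\<^sub>M ival h"
    by (rule finite_measure_pair_measure[OF finite_measure_ival finite_measure_ival])
  show ?thesis
  proof (rule P.integrable_const_bound)
    show "AE p in ival h \<Otimes>\<^sub>M ival h. norm (case_prod F p) \<le> B"
      using B by (intro AE_I2) (auto simp: space_pair_measure)
    show "case_prod F \<in> borel_measurable (ival h \<Otimes>\<^sub>M ival h)"
      using measurable_compose[OF pair_ival_borel bounded_borel2_measurable[OF F]] by simp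
  qed
qed

lemma bounded_borel_integral: assumes F: "bounded_borel2 h F" and h: "0 \<le> h" shows "bounded_borel h (\<lambda>x. LINT y|ival h. F x y)"
proof -
  obtain B where B: "\<And>x y. x \<in> {0..h} \<Longrightarrow> y \<in> {0..h} \<Longrightarrow> \<bar>F x y\<bar> \<le> B" using F by (rule bounded_borel2E) blast
  have 1: "(\<lambda>p. (fst p, snd p)) \<in> measurable (borel \<Otimes>\<^sub>M ival h) (borel \<Otimes>\<^sub>M borel)"
    by (rule measurable_Pair[OF measurable_fst measurable_compose[OF measurable_snd borel_ival[OF measurable_ident]], unfolded id_def])
  show ?thesis
  proof (rule bounded_borelI)
    have "(\<lambda>(x,y). F x y) \<in> borel_measurable (borel \<Otimes>\<^sub>M ival h)"
      using measurable_compose[OF 1 bounded_borel2_measurable[OF F]] by simp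
    then show "(\<lambda>x. LINT y|ival h. F x y) \<in> borel_measurable borel"
      by (rule ival.borel_measurable_lebesgue_integral)
  next
    fix x assume x: "x \<in> {0..h}"
    have "\<bar>LINT y|ival h. F x y\<bar> \<le> (LINT y|ival h. \<bar>F x y\<bar>)" by (rule integral_abs_bound)
    also have "\<dots> \<le> (LINT y|ival h. B)"
    proof (rule integral_mono)
      show "integrable (ival h) (\<lambda>y. \<bar>F x y\<bar>)" using bounded_borel_integrable[OF bounded_borel2_section1[OF F x]] by (rule integrable_abs)
    qed (use B x in auto)
    finally show "\<bar>LINT y|ival h. F x y\<bar> \<le> h * B" using h by simp
  qed
qed

lemma bounded_borel_Fubini: "bounded_borel2 h F \<Longrightarrow> (LINT x|ival h. LINT y|ival h. F x y) = (LINT y|ival h. LINT x|ival h. F x y)"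
  using ival2.Fubini_integral[OF bounded_borel2_integrable] by simp

lemma bounded_borel_integral_HK: assumes f: "bounded_borel h f" shows "(LINT x|ival h. f x) = integral {0..h} f" "f integrable_on {0..h}"
proof -
  have "set_integrable lborel {0<..<h} f"
    using bounded_borel_integrable[OF f] unfolding ival_def set_integrable_def
    by (subst (asm) integrable_restrict_space) auto
  from set_borel_integral_eq_integral[OF this]
  show "f integrable_on {0..h}" "(LINT x|ival h. f x) = integral {0..h} f"
    unfolding integral_open_interval_real ival_def set_lebesgue_integral_def
    by (auto simp: integral_restrict_space integrable_on_open_interval_real)
qed

lemmas bounded_borel_intros = bounded_borel_const bounded_borel_add bounded_borel_mult bounded_borel_diff bounded_borel_power2 bounded_borel2_add bounded_borel2_mult bounded_borel2_diff bounded_borel2_power2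

lemma bounded_borel_step: "bounded_borel h (\<lambda>t. if t \<le> x then 1 else 0)"
proof (rule bounded_borelI)
  show "(\<lambda>t. if t \<le> x then 1 else (0::real)) \<in> borel_measurable borel" by measurable
  show "\<bar>if t \<le> x then 1 else (0::real)\<bar> \<le> 1" for t by simp
qed

text \<open>
  Writing the indefinite integral with a step function under the integral sign makes it accessible
  to Fubini's theorem.
\<close>
lemma bounded_borel_step_integral:
  assumes f: "bounded_borel h f" and x: "x \<in> {0..h}"
  shows "(LINT t|ival h. (if t \<le> x then 1 else 0) * f t) = integral {0..x} f"
proof -
  have "(LINT t|ival h. (if t \<le> x then 1 else 0) * f t) = integral {0..h} (\<lambda>t. (if t \<le> x then 1 else 0) * f t)"
    by (intro bounded_borel_integral_HK bounded_borel_mult bounded_borel_step f)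
  also have "\<dots> = integral {0..h} (\<lambda>t. if t \<in> {0..x} then f t else 0)"
    by (intro Henstock_Kurzweil_Integration.integral_cong) auto
  also have "\<dots> = integral ({0..x} \<inter> {0..h}) f"
    by (rule Henstock_Kurzweil_Integration.integral_restrict_Int)
  also have "{0..x} \<inter> {0..h} = {0..x}" using x by auto
  finally show ?thesis .
qed

section \<open>Symmetric functions on the square\<close>

text \<open>
  The mean value minimises the mean square distance, so it can be replaced by the value at the
  midpoint \<open>c\<close>; then \<open>(p x - p c)\<^sup>2 \<le> \<bar>x - c\<bar> * \<integral> q\<^sup>2\<close> by the Cauchy-Schwarz inequality. The constant is not
  sharp: the optimal one is \<open>h\<^sup>2 / \<pi>\<^sup>2\<close>.
\<close>
lemma interval_poincare:
  assumes h: "h > 0" and p: "bounded_borel h p" and q: "bounded_borel h q"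
    and pq: "\<And>x. x \<in> {0..h} \<Longrightarrow> p x = p 0 + (LINT t|ival h. (if t \<le> x then 1 else 0) * q t)"
  shows "(LINT x|ival h. (p x)\<^sup>2) \<le> (LINT x|ival h. p x)\<^sup>2 / h + h\<^sup>2/3 * (LINT x|ival h. (q x)\<^sup>2)"
proof -
  define c where "c = h/2"
  define Q where "Q = (LINT x|ival h. (q x)\<^sup>2)"
  have Q0: "Q \<ge> 0" by (simp add: Q_def)
  have pt: "(p x - p c)\<^sup>2 \<le> ((x-c)\<^sup>2/h + h/4) * Q" if x: "x \<in> {0..h}" for x
  proof -
    have c: "c \<in> {0..h}" using h by (simp add: c_def)
    let ?f = "\<lambda>t. (if t \<le> x then 1 else 0) - (if t \<le> c then 1 else 0 :: real)"
    have bf: "bounded_borel h ?f" by (intro bounded_borel_intros bounded_borel_step)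
    have "p x - p c = (LINT t|ival h. (if t \<le> x then 1 else 0) * q t) - (LINT t|ival h. (if t \<le> c then 1 else 0) * q t)"
      using pq[OF x] pq[OF c] by linarith
    also have "\<dots> = (LINT t|ival h. (if t \<le> x then 1 else 0) * q t - (if t \<le> c then 1 else 0) * q t)"
      by (intro Bochner_Integration.integral_diff[symmetric] bounded_borel_integrable bounded_borel_intros bounded_borel_step q)
    also have "\<dots> = (LINT t|ival h. ?f t * q t)"
      by (intro Bochner_Integration.integral_cong) (auto simp: algebra_simps)
    finally have "(p x - p c)\<^sup>2 \<le> (LINT t|ival h. (?f t)\<^sup>2) * Q"
      using Cauchy_Schwarz_integral(2)[of ?f "ival h" q]
      using bounded_borel_integrable[OF bounded_borel_power2[OF bf]] bounded_borel_integrable[OF bounded_borel_power2[OF q]]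
        borel_ival[OF bounded_borel_borel[OF bf]] borel_ival[OF bounded_borel_borel[OF q]] by (simp only: Q_def)
    also have "(LINT t|ival h. (?f t)\<^sup>2) \<le> \<bar>x - c\<bar>"
    proof -
      let ?A = "{min x c<..max x c} \<inter> {0<..<h}"
      have "(LINT t|ival h. (?f t)\<^sup>2) = (LINT t|ival h. indicator ?A t)"
        by (intro Bochner_Integration.integral_cong) (auto simp: indicator_def)
      also have "\<dots> = measure lborel ?A"
        by (simp add: ival_def Int_assoc space_restrict_space measure_restrict_space)
      also have "\<dots> \<le> measure lborel {min x c<..max x c}"
        by (intro measure_mono_fmeasurable fmeasurableI) auto
      also have "\<dots> = \<bar>x - c\<bar>" by simp
      finally show ?thesis .
    qed
    \<comment> \<open>a polynomial bound is easier to integrate than the absolute value\<close>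
    also have "\<bar>x - c\<bar> \<le> (x-c)\<^sup>2/h + h/4"
    proof -
      have "0 \<le> (\<bar>x-c\<bar> - h/2)\<^sup>2" by simp
      then have "h * \<bar>x-c\<bar> \<le> (x-c)\<^sup>2 + h\<^sup>2/4" by (simp add: power2_diff field_simps)
      then show ?thesis using h by (simp add: field_simps power2_eq_square)
    qed
    finally show ?thesis using Q0 by (simp add: mult_right_mono)
  qed
  define S where "S = (LINT x|ival h. p x)"
  have "S\<^sup>2/h \<ge> 2 * p c * S - h * (p c)\<^sup>2"
  proof -
    have "0 \<le> (S - h * p c)\<^sup>2" by simp
    then show ?thesis using h by (simp add: power2_eq_square field_simps)
  qed
  moreover have "(LINT x|ival h. (p x - p c)\<^sup>2) = (LINT x|ival h. (p x)\<^sup>2) - 2 * p c * S + h * (p c)\<^sup>2"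
  proof -
    have "(LINT x|ival h. (p x - p c)\<^sup>2) = (LINT x|ival h. (p x)\<^sup>2 - 2 * p c * p x + (p c)\<^sup>2)"
      by (intro Bochner_Integration.integral_cong) (auto simp: power2_eq_square algebra_simps)
    then show ?thesis using h by (simp add: S_def bounded_borel_integrable bounded_borel_power2 p)
  qed
  moreover have "(LINT x|ival h. (p x - p c)\<^sup>2) \<le> (LINT x|ival h. ((x-c)\<^sup>2/h + h/4) * Q)"
    using pt h by (intro integral_mono bounded_borel_integrable bounded_borel_intros p bounded_borel_cont continuous_intros) auto
  moreover have "(LINT x|ival h. ((x-c)\<^sup>2/h + h/4) * Q) = h\<^sup>2/3 * Q"
  proof -
    have "(LINT x|ival h. (x-c)\<^sup>2/h + h/4) = integral {0..h} (\<lambda>x. (x-c)\<^sup>2/h + h/4)"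
      using h by (intro bounded_borel_integral_HK bounded_borel_cont continuous_intros) auto
    also have "\<dots> = ((h-c)^3/(3*h) + h/4 * h) - ((0-c)^3/(3*h) + h/4 * 0)"
      using h by (intro integral_unique fundamental_theorem_of_calculus)
        (auto intro!: derivative_eq_intros simp: power2_eq_square field_simps simp flip: has_real_derivative_iff_has_vector_derivative)
    also have "\<dots> = h\<^sup>2/3" using h by (simp add: c_def field_simps eval_nat_numeral)
    finally show ?thesis by simp
  qed
  ultimately show ?thesis unfolding S_def[symmetric] Q_def[symmetric] by linarith
qed
text \<open>
  The splitting \<open>w = g x + s\<close> and \<open>v = g' x + q\<close> is orthogonal on every vertical line. On the horizontal
  lines the mean of \<open>s\<close> is \<open>g y - mean g\<close> by symmetry, so there the Poincare inequality bounds \<open>\<integral>\<integral> s\<^sup>2\<close>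
  by \<open>h * \<integral> (g - mean g)\<^sup>2\<close> and \<open>\<integral>\<integral> q\<^sup>2\<close>. What remains is the nonlocal inequality for \<open>g\<close>. The slack between
  \<open>z\<^sup>2 \<approx> 4.1\<close> and \<open>6\<close> pays for the crude constant.
\<close>
lemma square_inequality:
  fixes w v :: "real \<Rightarrow> real \<Rightarrow> real"
  assumes h: "h > 0" and z: "0 < z" "z < pi" "z * cot z + 1 = 0" and z6: "z\<^sup>2 \<le> 6"
    and w: "bounded_borel2 h w" and v: "bounded_borel2 h v" and sym: "\<And>x y. w x y = w y x"
    and wv: "\<And>x y. x \<in> {0..h} \<Longrightarrow> y \<in> {0..h} \<Longrightarrow>
       w x y = w 0 y + (LINT t|ival h. (if t \<le> x then 1 else 0) * v t y)"
    and cv: "continuous_on {0..h} (\<lambda>x. LINT y|ival h. v x y)"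
    and trace: "(LINT y|ival h. w h y) = 0"
  shows "(z/h)\<^sup>2 / 2 * (LINT x|ival h. LINT y|ival h. (w x y)\<^sup>2) \<le> (LINT x|ival h. LINT y|ival h. (v x y)\<^sup>2)"
proof -
  define g g' where "g x = (LINT y|ival h. w x y) / h" and "g' x = (LINT y|ival h. v x y) / h" for x
  have bw: "bounded_borel h (\<lambda>x. LINT y|ival h. w x y)" and bv: "bounded_borel h (\<lambda>x. LINT y|ival h. v x y)"
    using bounded_borel_integral w v h by auto
  have bg: "bounded_borel h g" "bounded_borel h g'"
    using bounded_borel_mult[OF bw bounded_borel_const[of h "1/h"]] bounded_borel_mult[OF bv bounded_borel_const[of h "1/h"]]
    by (simp_all add: g_def[abs_def] g'_def[abs_def])
  have Sg: "(LINT y|ival h. w x y) = h * g x" "(LINT y|ival h. v x y) = h * g' x" for x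
    using h by (simp_all add: g_def g'_def)
  have cg': "continuous_on {0..h} g'" unfolding g'_def by (intro continuous_intros cv) (use h in auto)
  have gFTC: "g x = g 0 + (LINT t|ival h. (if t \<le> x then 1 else 0) * g' t)" if x: "x \<in> {0..h}" for x
  proof -
    have b: "bounded_borel2 h (\<lambda>y t. (if t \<le> x then 1 else 0) * v t y)"
      by (intro bounded_borel2_mult bounded_borel2_snd bounded_borel_step bounded_borel2_swap[OF v])
    have "(LINT y|ival h. w x y) = (LINT y|ival h. w 0 y + (LINT t|ival h. (if t \<le> x then 1 else 0) * v t y))"
      using wv[OF x] by (intro Bochner_Integration.integral_cong) auto
    also have "\<dots> = (LINT y|ival h. w 0 y) + (LINT y|ival h. LINT t|ival h. (if t \<le> x then 1 else 0) * v t y)"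
      using h by (intro Bochner_Integration.integral_add bounded_borel_integrable bounded_borel_integral[OF b] bounded_borel2_section1[OF w]) auto
    also have "(LINT y|ival h. LINT t|ival h. (if t \<le> x then 1 else 0) * v t y)
        = (LINT t|ival h. LINT y|ival h. (if t \<le> x then 1 else 0) * v t y)"
      by (rule bounded_borel_Fubini[OF b])
    also have "\<dots> = (LINT t|ival h. h * ((if t \<le> x then 1 else 0) * g' t))"
      by (simp add: Sg mult_ac)
    finally have "h * g x = h * (g 0 + (LINT t|ival h. (if t \<le> x then 1 else 0) * g' t))"
      by (simp add: Sg distrib_left)
    then show ?thesis using h by simp
  qed
  have gHK: "g x = g 0 + integral {0..x} g'" if x: "x \<in> {0..h}" for x
  proof -
    show ?thesis using gFTC[OF x] bounded_borel_step_integral[OF bg(2) x] by simp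
  qed
  have dg: "(g has_real_derivative g' x) (at x within {0..h})" if x: "x \<in> {0..h}" for x
  proof -
    have "((\<lambda>x. g 0 + integral {0..x} g') has_real_derivative 0 + g' x) (at x within {0..h})"
      by (intro DERIV_add DERIV_const integral_has_real_derivative cg' x)
    then have "((\<lambda>x. g 0 + integral {0..x} g') has_real_derivative g' x) (at x within {0..h})" by simp
    then show ?thesis
    proof (rule has_field_derivative_transform_within[OF _ zero_less_one x])
      show "g 0 + integral {0..y} g' = g y" if "y \<in> {0..h}" for y using gHK[OF that] by simp
    qed
  qed
  define G A A' where "G = (LINT x|ival h. g x)" and "A = (LINT x|ival h. (g x)\<^sup>2)" and "A' = (LINT x|ival h. (g' x)\<^sup>2)"
  have oned: "(z/h)\<^sup>2 * (A - G\<^sup>2 / (2*h)) \<le> A'"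
    unfolding G_def A_def A'_def bounded_borel_integral_HK(1)[OF bg(1)]
      bounded_borel_integral_HK(1)[OF bounded_borel_power2[OF bg(1)]] bounded_borel_integral_HK(1)[OF bounded_borel_power2[OF bg(2)]]
    by (rule nonlocal_interval_inequality[OF h z dg cg']) (simp_all add: g_def trace)
  \<comment> \<open>the parts of \<open>w\<close> and \<open>v\<close> with mean zero on vertical lines\<close>
  define s q where "s x y = w x y - g x" and "q x y = v x y - g' x" for x y
  have bs: "bounded_borel2 h s" "bounded_borel2 h q" unfolding s_def[abs_def] q_def[abs_def]
    by (intro bounded_borel2_diff bounded_borel2_fst bg w v)+
  define S R where "S = (LINT x|ival h. LINT y|ival h. (s x y)\<^sup>2)" and "R = (LINT x|ival h. LINT y|ival h. (q x y)\<^sup>2)"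
  have split: "(LINT x|ival h. LINT y|ival h. (f x y)\<^sup>2) = h * (LINT x|ival h. (a x)\<^sup>2) + (LINT x|ival h. LINT y|ival h. (f x y - a x)\<^sup>2)"
    if f: "bounded_borel2 h f" and a: "bounded_borel h a" and fa: "\<And>x. (LINT y|ival h. f x y) = h * a x" for f a
  proof -
    have "(LINT y|ival h. (f x y)\<^sup>2) = h * (a x)\<^sup>2 + (LINT y|ival h. (f x y - a x)\<^sup>2)" if x: "x \<in> {0..h}" for x
    proof -
      have b: "bounded_borel h (f x)" using f x by (rule bounded_borel2_section1)
      have "(LINT y|ival h. (f x y - a x)\<^sup>2) = (LINT y|ival h. (f x y)\<^sup>2 - 2 * a x * f x y + (a x)\<^sup>2)"
        by (intro Bochner_Integration.integral_cong) (auto simp: power2_eq_square algebra_simps)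
      also have "\<dots> = (LINT y|ival h. (f x y)\<^sup>2) - 2 * a x * (LINT y|ival h. f x y) + h * (a x)\<^sup>2"
        using h by (simp add: bounded_borel_integrable bounded_borel_power2 b)
      finally show ?thesis unfolding fa by (simp add: power2_eq_square)
    qed
    then have "(LINT x|ival h. LINT y|ival h. (f x y)\<^sup>2)
      = (LINT x|ival h. h * (a x)\<^sup>2 + (LINT y|ival h. (f x y - a x)\<^sup>2))"
      by (intro Bochner_Integration.integral_cong) auto
    also have "\<dots> = (LINT x|ival h. h * (a x)\<^sup>2) + (LINT x|ival h. LINT y|ival h. (f x y - a x)\<^sup>2)"
      using h by (intro Bochner_Integration.integral_add bounded_borel_integrable bounded_borel_mult bounded_borel_const bounded_borel_power2 a bounded_borel_integral bounded_borel2_power2 bounded_borel2_diff bounded_borel2_fst f) auto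
    finally show ?thesis by simp
  qed
  have W: "(LINT x|ival h. LINT y|ival h. (w x y)\<^sup>2) = h * A + S"
    unfolding A_def S_def s_def using w bg(1) Sg(1) by (rule split)
  have V: "(LINT x|ival h. LINT y|ival h. (v x y)\<^sup>2) = h * A' + R"
    unfolding A'_def R_def q_def using v bg(2) Sg(2) by (rule split)
  have line: "(LINT x|ival h. (s x y)\<^sup>2) \<le> h * (g y - G/h)\<^sup>2 + h\<^sup>2/3 * (LINT x|ival h. (q x y)\<^sup>2)"
    if y: "y \<in> {0..h}" for y
  proof -
    have "s x y = s 0 y + (LINT t|ival h. (if t \<le> x then 1 else 0) * q t y)" if x: "x \<in> {0..h}" for x
    proof -
      have "(LINT t|ival h. (if t \<le> x then 1 else 0) * q t y) =
         (LINT t|ival h. (if t \<le> x then 1 else 0) * v t y - (if t \<le> x then 1 else 0) * g' t)"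
        by (simp add: q_def right_diff_distrib)
      also have "\<dots> = (LINT t|ival h. (if t \<le> x then 1 else 0) * v t y) - (LINT t|ival h. (if t \<le> x then 1 else 0) * g' t)"
        by (intro Bochner_Integration.integral_diff bounded_borel_integrable bounded_borel_mult bounded_borel_step bounded_borel2_section2[OF v y] bg)
      finally show ?thesis using wv[OF x y] gFTC[OF x] by (simp add: s_def)
    qed
    from interval_poincare[OF h bounded_borel2_section2[OF bs(1) y] bounded_borel2_section2[OF bs(2) y] this]
    have "(LINT x|ival h. (s x y)\<^sup>2) \<le> (LINT x|ival h. s x y)\<^sup>2 / h + h\<^sup>2/3 * (LINT x|ival h. (q x y)\<^sup>2)" .
    moreover have "(LINT x|ival h. s x y) = h * (g y - G/h)"
    proof -
      have "(LINT x|ival h. s x y) = (LINT x|ival h. w x y) - G"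
        unfolding s_def G_def by (intro Bochner_Integration.integral_diff bounded_borel_integrable bounded_borel2_section2[OF w y] bg)
      also have "(LINT x|ival h. w x y) = h * g y" using Sg(1)[of y] by (simp add: sym[of _ y])
      finally show ?thesis using h by (simp add: right_diff_distrib)
    qed
    moreover have "(h * (g y - G/h))\<^sup>2 / h = h * (g y - G/h)\<^sup>2" using h by (simp add: power2_eq_square)
    ultimately show ?thesis by simp
  qed
  have "S = (LINT y|ival h. LINT x|ival h. (s x y)\<^sup>2)"
    unfolding S_def by (rule bounded_borel_Fubini[OF bounded_borel2_power2[OF bs(1)]])
  also have "\<dots> \<le> (LINT y|ival h. h * (g y - G/h)\<^sup>2 + h\<^sup>2/3 * (LINT x|ival h. (q x y)\<^sup>2))"
    using h line by (intro integral_mono bounded_borel_integrable bounded_borel_integral bounded_borel_intros bg bounded_borel2_power2 bounded_borel2_swap[OF bs(1)] bounded_borel2_swap[OF bs(2)]) auto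
  also have "\<dots> = (LINT y|ival h. h * (g y - G/h)\<^sup>2) + (LINT y|ival h. h\<^sup>2/3 * (LINT x|ival h. (q x y)\<^sup>2))"
    using h by (intro Bochner_Integration.integral_add bounded_borel_integrable bounded_borel_integral bounded_borel_intros bg bounded_borel2_power2 bounded_borel2_swap[OF bs(2)]) auto
  also have "(LINT y|ival h. h\<^sup>2/3 * (LINT x|ival h. (q x y)\<^sup>2)) = h\<^sup>2/3 * R"
    unfolding R_def using bounded_borel_Fubini[OF bounded_borel2_power2[OF bs(2)]] by simp
  also have "(LINT y|ival h. h * (g y - G/h)\<^sup>2) = h * A - G\<^sup>2"
  proof -
    have "(LINT y|ival h. (g y - G/h)\<^sup>2) = (LINT y|ival h. (g y)\<^sup>2 - 2 * (G/h) * g y + (G/h)\<^sup>2)"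
      by (intro Bochner_Integration.integral_cong) (auto simp: power2_eq_square algebra_simps)
    also have "\<dots> = A - 2 * (G/h) * G + h * (G/h)\<^sup>2"
      using h unfolding A_def G_def by (simp add: bounded_borel_integrable bounded_borel_power2 bg)
    also have "\<dots> = A - G\<^sup>2/h" using h by (simp add: power2_eq_square field_simps)
    finally have "(LINT y|ival h. (g y - G/h)\<^sup>2) = A - G\<^sup>2/h" .
    moreover have "(LINT y|ival h. h * (g y - G/h)\<^sup>2) = h * (LINT y|ival h. (g y - G/h)\<^sup>2)" by simp
    ultimately show ?thesis using h by (simp add: right_diff_distrib)
  qed
  finally have S: "S \<le> h * A - G\<^sup>2 + h\<^sup>2/3 * R" .
  have "(z/h)\<^sup>2 / 2 * (h * A + S) \<le> (z/h)\<^sup>2 / 2 * (2 * h * A - G\<^sup>2 + h\<^sup>2/3 * R)"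
  proof (rule mult_left_mono)
    show "h * A + S \<le> 2 * h * A - G\<^sup>2 + h\<^sup>2/3 * R" using S by linarith
  qed simp
  also have "\<dots> = h * ((z/h)\<^sup>2 * (A - G\<^sup>2 / (2*h))) + z\<^sup>2/6 * R"
    using h by (simp add: field_simps power2_eq_square)
  also have "\<dots> \<le> h * A' + 1 * R"
    using oned z6 h by (intro add_mono mult_left_mono mult_right_mono) (auto simp: R_def)
  finally show ?thesis unfolding W V by simp
qed

section \<open>From the triangle to the square\<close>

definition right_triangle :: "real \<Rightarrow> (real \<times> real) set" where
  "right_triangle h = {(x1, x2). 0 < x2 \<and> x2 < x1 \<and> x1 < h}"

lemma open_right_triangle: "open (right_triangle h)"
proof -
  have "open {p::real\<times>real. 0 < snd p \<and> snd p < fst p \<and> fst p < h}"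
    by (intro open_Collect_conj open_Collect_less continuous_intros)
  then show ?thesis by (simp add: right_triangle_def case_prod_unfold)
qed

lemma bounded_borel2_cont:
  assumes c: "continuous_on UNIV f" shows "bounded_borel2 h (\<lambda>x y. f (x, y))"
proof -
  have "bounded (f ` ({0..h} \<times> {0..h}))"
    by (rule compact_imp_bounded[OF compact_continuous_image[OF continuous_on_subset[OF c]]]) (auto intro: compact_Times)
  then obtain B where "\<forall>x\<in>f ` ({0..h} \<times> {0..h}). norm x \<le> B" unfolding bounded_iff by blast
  moreover have "(\<lambda>(x,y). f (x,y)) = f" by auto
  ultimately show ?thesis
    using borel_measurable_continuous_onI[OF c] by (intro bounded_borel2I[of _ h B]) auto
qed

lemma bounded_borel2_less: "bounded_borel2 h (\<lambda>x y. if y < x then 1 else 0)"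
proof (rule bounded_borel2I)
  have "(\<lambda>(x, y). if y < x then 1 else 0 :: real) \<in> borel_measurable (borel \<Otimes>\<^sub>M (borel :: real measure))"
    by measurable
  then show "(\<lambda>(x, y). if y < x then 1 else 0 :: real) \<in> borel_measurable (borel :: (real \<times> real) measure)"
    by (simp only: borel_prod)
  show "\<bar>if y < x then 1 else 0 :: real\<bar> \<le> 1" for x y :: real by simp
qed

lemma bounded_borel2_if:
  assumes "bounded_borel2 h F" "bounded_borel2 h G" shows "bounded_borel2 h (\<lambda>x y. if y < x then F x y else G x y)"
proof -
  have "bounded_borel2 h (\<lambda>x y. (if y < x then 1 else 0) * F x y + (1 - (if y < x then 1 else 0)) * G x y)"
    by (intro bounded_borel2_add bounded_borel2_mult bounded_borel2_diff bounded_borel2_less assms bounded_borel2_fst bounded_borel_const)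
  moreover have "(\<lambda>x y. (if y < x then 1 else 0) * F x y + (1 - (if y < x then 1 else 0)) * G x y)
      = (\<lambda>x y. if y < x then F x y else G x y)" by (intro ext) simp
  ultimately show ?thesis by simp
qed

lemma lborel_integral_ival: "(LINT x|ival h. f x) = (LINT x|lborel. indicator {0<..<h} x *\<^sub>R f x)"
  for f :: "real \<Rightarrow> real"
  unfolding ival_def by (rule integral_restrict_space) simp

lemma integrable_triangle_lborel:
  fixes f :: "real \<times> real \<Rightarrow> real"
  assumes c: "continuous_on UNIV f"
  shows "integrable lborel (\<lambda>p. indicator (right_triangle h) p *\<^sub>R f p)"
proof -
  have "set_integrable lborel ({0..h} \<times> {0..h}) f"
    unfolding set_integrable_def
    by (rule borel_integrable_compact[OF compact_Times[OF compact_Icc compact_Icc] continuous_on_subset[OF c]]) simp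
  then have "set_integrable lborel (right_triangle h) f"
    by (rule set_integrable_subset) (auto simp: right_triangle_def intro: borel_open[OF open_right_triangle, unfolded right_triangle_def])
  then show ?thesis unfolding set_integrable_def .
qed

lemma triangle_integral:
  fixes f :: "real \<times> real \<Rightarrow> real"
  assumes c: "continuous_on UNIV f"
  shows "integrable (lebesgue_on (right_triangle h)) f"
    and "(LINT p|lebesgue_on (right_triangle h). f p) = (LINT x|ival h. LINT y|ival h. (if y < x then f (x,y) else 0))"
proof -
  let ?g = "\<lambda>p. indicator (right_triangle h) p *\<^sub>R f p"
  have T: "right_triangle h \<in> sets borel" using open_right_triangle by (rule borel_open)
  have ig: "integrable lborel ?g" by (rule integrable_triangle_lborel[OF c])
  have mg: "?g \<in> borel_measurable lborel" using ig by (rule borel_measurable_integrable)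
  have "integrable lebesgue ?g" using ig mg by (simp add: integrable_completion)
  then show "integrable (lebesgue_on (right_triangle h)) f"
    using T by (subst integrable_restrict_space) auto
  have "(LINT p|lebesgue_on (right_triangle h). f p) = (LINT p|lebesgue. ?g p)"
    using T by (intro integral_restrict_space) auto
  also have "\<dots> = (LINT p|lborel. ?g p)" using mg by (rule integral_completion)
  also have "\<dots> = (LINT x|lborel. LINT y|lborel. ?g (x,y))"
    using lborel_pair.integral_fst'[of ?g] ig by (simp add: lborel_prod)
  also have "\<dots> = (LINT x|lborel. indicator {0<..<h} x *\<^sub>R (LINT y|ival h. (if y < x then f (x,y) else 0)))"
  proof (intro Bochner_Integration.integral_cong refl)
    fix x :: real
    have "(LINT y|lborel. ?g (x,y)) = (LINT y|lborel. indicator {0<..<h} x *\<^sub>R (indicator {0<..<h} y *\<^sub>R (if y < x then f (x,y) else 0)))"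
      by (intro Bochner_Integration.integral_cong refl) (auto simp: right_triangle_def indicator_def)
    then show "(LINT y|lborel. ?g (x,y)) = indicator {0<..<h} x *\<^sub>R (LINT y|ival h. (if y < x then f (x,y) else 0))"
      by (simp add: lborel_integral_ival)
  qed
  finally show "(LINT p|lebesgue_on (right_triangle h). f p) = (LINT x|ival h. LINT y|ival h. (if y < x then f (x,y) else 0))"
    by (simp add: lborel_integral_ival)
qed

lemma AE_ival_neq: "AE y in ival h. y \<noteq> x"
  unfolding ival_def using AE_lborel_singleton[of x] by (subst AE_restrict_space_iff) auto

text \<open>
  The part of the square above the diagonal is the mirror image of the triangle, and the diagonal is
  a null set.
\<close>
lemma reflect_integral:
  fixes f1 f2 :: "real \<times> real \<Rightarrow> real"
  assumes c: "continuous_on UNIV f1" "continuous_on UNIV f2" and h: "h \<ge> 0"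
  shows "(LINT x|ival h. LINT y|ival h. (if y < x then f1 (x,y) else f2 (y,x)))
    = (LINT p|lebesgue_on (right_triangle h). f1 p) + (LINT p|lebesgue_on (right_triangle h). f2 p)"
proof -
  let ?A = "\<lambda>x y. if y < x then f1 (x,y) else 0" and ?B = "\<lambda>x y. if y < x then f2 (x,y) else 0"
  have A: "bounded_borel2 h ?A" and B: "bounded_borel2 h ?B" by (intro bounded_borel2_if bounded_borel2_cont c bounded_borel2_fst bounded_borel_const)+
  note B' = bounded_borel2_swap[OF B]
  have "(LINT y|ival h. (if y < x then f1 (x,y) else f2 (y,x))) = (LINT y|ival h. ?A x y) + (LINT y|ival h. ?B y x)"
    if x: "x \<in> {0..h}" for x
  proof -
    have "(LINT y|ival h. (if y < x then f1 (x,y) else f2 (y,x))) = (LINT y|ival h. ?A x y + ?B y x)"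
    proof (rule integral_cong_AE)
      have "bounded_borel h (\<lambda>y. if y < x then f1 (x,y) else f2 (y,x))"
        by (rule bounded_borel2_section1[OF bounded_borel2_if[OF bounded_borel2_cont[OF c(1)] bounded_borel2_swap[OF bounded_borel2_cont[OF c(2)]]] x])
      then show "(\<lambda>y. if y < x then f1 (x,y) else f2 (y,x)) \<in> borel_measurable (ival h)"
        by (intro bounded_borel_ival)
      show "(\<lambda>y. ?A x y + ?B y x) \<in> borel_measurable (ival h)"
        by (intro bounded_borel_ival bounded_borel_add bounded_borel2_section1[OF A x] bounded_borel2_section1[OF B' x])
      show "AE y in ival h. (if y < x then f1 (x,y) else f2 (y,x)) = ?A x y + ?B y x"
        using AE_ival_neq[of x h] by eventually_elim auto
    qed
    also have "\<dots> = (LINT y|ival h. ?A x y) + (LINT y|ival h. ?B y x)"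
      by (intro Bochner_Integration.integral_add bounded_borel_integrable bounded_borel2_section1[OF A x] bounded_borel2_section1[OF B' x])
    finally show ?thesis .
  qed
  then have "(LINT x|ival h. LINT y|ival h. (if y < x then f1 (x,y) else f2 (y,x)))
     = (LINT x|ival h. (LINT y|ival h. ?A x y) + (LINT y|ival h. ?B y x))"
    by (intro Bochner_Integration.integral_cong) auto
  also have "\<dots> = (LINT x|ival h. LINT y|ival h. ?A x y) + (LINT x|ival h. LINT y|ival h. ?B y x)"
    by (intro Bochner_Integration.integral_add bounded_borel_integrable bounded_borel_integral A B' h)
  also have "(LINT x|ival h. LINT y|ival h. ?B y x) = (LINT x|ival h. LINT y|ival h. ?B x y)"
    by (rule bounded_borel_Fubini[OF B'])
  finally show ?thesis by (simp only: triangle_integral(2)[OF c(1)] triangle_integral(2)[OF c(2)])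
qed

lemma partial_derivatives:
  fixes u :: "real \<times> real \<Rightarrow> real"
  assumes "u differentiable (at (x,y))"
  shows "((\<lambda>t. u (t, y)) has_real_derivative frechet_derivative u (at (x,y)) (1,0)) (at x)"
    and "((\<lambda>t. u (x, t)) has_real_derivative frechet_derivative u (at (x,y)) (0,1)) (at y)"
proof -
  let ?D = "frechet_derivative u (at (x,y))"
  have D: "(u has_derivative ?D) (at (x,y))" using assms by (simp add: frechet_derivative_works)
  have lin: "linear ?D" using D by (rule has_derivative_linear)
  have "?D (s, 0) = ?D (1, 0) * s" for s
    using linear_scale[OF lin, of s "(1,0)"] by simp
  then have 1: "(\<lambda>s. ?D (s, 0)) = (*) (?D (1, 0))" by (rule ext)
  have "?D (0, s) = ?D (0, 1) * s" for s
    using linear_scale[OF lin, of s "(0,1)"] by simp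
  then have 2: "(\<lambda>s. ?D (0, s)) = (*) (?D (0, 1))" by (rule ext)
  have "((\<lambda>t. (t, y)) has_derivative (\<lambda>s. (s, 0))) (at x)"
    by (intro has_derivative_Pair has_derivative_ident has_derivative_const)
  from has_derivative_compose[OF this D]
  show "((\<lambda>t. u (t, y)) has_real_derivative ?D (1,0)) (at x)"
    unfolding has_field_derivative_def by (simp only: 1)
  have "((\<lambda>t. (x, t)) has_derivative (\<lambda>s. (0, s))) (at y)"
    by (intro has_derivative_Pair has_derivative_ident has_derivative_const)
  from has_derivative_compose[OF this D]
  show "((\<lambda>t. u (x, t)) has_real_derivative ?D (0,1)) (at y)"
    unfolding has_field_derivative_def by (simp only: 2)
qed

text \<open>
  The reflected function \<open>w\<close> has a kink on the diagonal only, so on each horizontal line it is the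
  integral of its derivative \<open>v\<close>. The section integrals of \<open>v\<close> depend continuously on \<open>x\<close> by dominated
  convergence, although \<open>v\<close> itself jumps.
\<close>
lemma triangle_inequality:
  fixes u :: "real \<times> real \<Rightarrow> real"
  defines "D1 \<equiv> \<lambda>p. frechet_derivative u (at p) (1,0)" and "D2 \<equiv> \<lambda>p. frechet_derivative u (at p) (0,1)"
  assumes h: "h > 0" and z: "0 < z" "z < pi" "z * cot z + 1 = 0" and z6: "z\<^sup>2 \<le> 6"
    and d: "\<And>p. u differentiable (at p)" and c1: "continuous_on UNIV D1" and c2: "continuous_on UNIV D2"
    and mean: "(LINT y|ival h. u (h, y)) = 0"
  shows "(z/h)\<^sup>2 * (LINT p|lebesgue_on (right_triangle h). (u p)\<^sup>2)
     \<le> (LINT p|lebesgue_on (right_triangle h). (D1 p)\<^sup>2) + (LINT p|lebesgue_on (right_triangle h). (D2 p)\<^sup>2)"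
proof -
  have cu: "continuous_on UNIV u"
    using d by (intro differentiable_imp_continuous_on) (auto simp: differentiable_on_def differentiable_at_withinI)
  define w v where "w x y = u (max x y, min x y)" and "v x y = (if y < x then D1 (x,y) else D2 (y,x))" for x y
  have w_if: "w x y = (if y < x then u (x,y) else u (y,x))" for x y by (simp add: w_def max_def min_def)
  have bw: "bounded_borel2 h w"
    unfolding w_if[abs_def] by (rule bounded_borel2_if[OF bounded_borel2_cont[OF cu] bounded_borel2_swap[OF bounded_borel2_cont[OF cu]]])
  have bv: "bounded_borel2 h v"
    unfolding v_def[abs_def] by (rule bounded_borel2_if[OF bounded_borel2_cont[OF c1] bounded_borel2_swap[OF bounded_borel2_cont[OF c2]]])
  have "(z/h)\<^sup>2 / 2 * (LINT x|ival h. LINT y|ival h. (w x y)\<^sup>2) \<le> (LINT x|ival h. LINT y|ival h. (v x y)\<^sup>2)"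
  proof (rule square_inequality[OF h z z6 bw bv])
    show "w x y = w y x" for x y by (simp add: w_def max.commute min.commute)
  next
    fix x y assume x: "x \<in> {0..h}" and y: "y \<in> {0..h}"
    have "((\<lambda>t. v t y) has_integral (w x y - w 0 y)) {0..x}"
    proof (rule fundamental_theorem_of_calculus_interior_strong[of "{y}"])
      show "continuous_on {0..x} (\<lambda>t. w t y)"
        unfolding w_def by (intro continuous_on_compose2[OF cu] continuous_intros) auto
      fix t assume t: "t \<in> {0<..<x} - {y}"
      have "((\<lambda>t. w t y) has_real_derivative v t y) (at t)"
      proof (cases "y < t")
        case True
        have "((\<lambda>t. u (t, y)) has_real_derivative v t y) (at t)"
          using partial_derivatives(1)[OF d] True by (simp add: v_def D1_def)
        then show ?thesis
          by (rule has_field_derivative_transform_within_open[where S="{y<..}"]) (use True in \<open>auto simp: w_if\<close>)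
      next
        case False
        then have "t < y" using t by auto
        have "((\<lambda>t. u (y, t)) has_real_derivative v t y) (at t)"
          using partial_derivatives(2)[OF d] False by (simp add: v_def D2_def)
        then show ?thesis
          by (rule has_field_derivative_transform_within_open[where S="{..<y}"]) (use \<open>t < y\<close> in \<open>auto simp: w_if\<close>)
      qed
      then show "((\<lambda>t. w t y) has_vector_derivative v t y) (at t)"
        by (simp add: has_real_derivative_iff_has_vector_derivative)
    qed (use x in auto)
    then show "w x y = w 0 y + (LINT t|ival h. (if t \<le> x then 1 else 0) * v t y)"
      by (simp add: bounded_borel_step_integral[OF bounded_borel2_section2[OF bv y] x] integral_unique)
  next
    show "continuous_on {0..h} (\<lambda>x. LINT y|ival h. v x y)"
      unfolding continuous_on_sequentially
    proof (intro allI ballI impI)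
      fix s :: "nat \<Rightarrow> real" and a assume a: "a \<in> {0..h}" and s: "(\<forall>n. s n \<in> {0..h}) \<and> s \<longlonglongrightarrow> a"
      obtain B where B: "\<And>x y. x \<in> {0..h} \<Longrightarrow> y \<in> {0..h} \<Longrightarrow> \<bar>v x y\<bar> \<le> B" using bv by (rule bounded_borel2E) blast
      have "(\<lambda>n. LINT y|ival h. v (s n) y) \<longlonglongrightarrow> (LINT y|ival h. v a y)"
      proof (rule integral_dominated_convergence[where w="\<lambda>_. B"])
        show "v a \<in> borel_measurable (ival h)" by (intro bounded_borel_ival bounded_borel2_section1[OF bv a])
        show "v (s n) \<in> borel_measurable (ival h)" for n using s by (intro bounded_borel_ival bounded_borel2_section1[OF bv]) auto
        show "AE y in ival h. norm (v (s n) y) \<le> B" for n using B s by (intro AE_I2) auto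
        show "AE y in ival h. (\<lambda>n. v (s n) y) \<longlonglongrightarrow> v a y"
          using AE_ival_neq[of a h]
        proof eventually_elim
          fix y assume "y \<noteq> a"
          show "(\<lambda>n. v (s n) y) \<longlonglongrightarrow> v a y"
          proof (cases "y < a")
            case True
            have "(\<lambda>n. D1 (s n, y)) \<longlonglongrightarrow> D1 (a, y)"
              using s c1 by (intro continuous_on_tendsto_compose[OF c1] tendsto_Pair tendsto_const) auto
            moreover have "\<forall>\<^sub>F n in sequentially. y < s n" using s True order_tendstoD(1) by blast
            then have "\<forall>\<^sub>F n in sequentially. D1 (s n, y) = v (s n) y" by (rule eventually_mono) (simp add: v_def)
            ultimately show ?thesis using True by (auto simp: v_def intro: Lim_transform_eventually)
          next
            case False
            then have "a < y" using \<open>y \<noteq> a\<close> by simp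
            have "(\<lambda>n. D2 (y, s n)) \<longlonglongrightarrow> D2 (y, a)"
              using s by (intro continuous_on_tendsto_compose[OF c2] tendsto_Pair tendsto_const) auto
            moreover have "\<forall>\<^sub>F n in sequentially. s n < y" using s \<open>a < y\<close> order_tendstoD(2) by blast
            then have "\<forall>\<^sub>F n in sequentially. D2 (y, s n) = v (s n) y" by (rule eventually_mono) (simp add: v_def)
            ultimately show ?thesis using False by (auto simp: v_def intro: Lim_transform_eventually)
          qed
        qed
      qed simp
      then show "((\<lambda>x. LINT y|ival h. v x y) \<circ> s) \<longlonglongrightarrow> (LINT y|ival h. v a y)" by (simp add: o_def)
    qed
  next
    have "(LINT y|ival h. w h y) = (LINT y|ival h. u (h, y))"
      by (intro Bochner_Integration.integral_cong) (auto simp: w_def max_def min_def)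
    then show "(LINT y|ival h. w h y) = 0" using mean by simp
  qed
  moreover have "(LINT x|ival h. LINT y|ival h. (w x y)\<^sup>2) = 2 * (LINT p|lebesgue_on (right_triangle h). (u p)\<^sup>2)"
  proof -
    have "(w x y)\<^sup>2 = (if y < x then (u (x,y))\<^sup>2 else (u (y,x))\<^sup>2)" for x y by (simp add: w_if)
    then show ?thesis using h
      by (simp only: reflect_integral[of "\<lambda>p. (u p)\<^sup>2" "\<lambda>p. (u p)\<^sup>2" h] continuous_on_power[OF cu] less_imp_le mult_2)
  qed
  moreover have "(LINT x|ival h. LINT y|ival h. (v x y)\<^sup>2) =
     (LINT p|lebesgue_on (right_triangle h). (D1 p)\<^sup>2) + (LINT p|lebesgue_on (right_triangle h). (D2 p)\<^sup>2)"
  proof -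
    have "(v x y)\<^sup>2 = (if y < x then (D1 (x,y))\<^sup>2 else (D2 (y,x))\<^sup>2)" for x y by (simp add: v_def)
    then show ?thesis using h
      by (simp only: reflect_integral[of "\<lambda>p. (D1 p)\<^sup>2" "\<lambda>p. (D2 p)\<^sup>2" h] continuous_on_power[OF c1] continuous_on_power[OF c2] less_imp_le)
  qed
  ultimately show ?thesis by simp
qed
lemma Basis_plane: "(Basis :: (real \<times> real) set) = {(1,0), (0,1)}"
  by (auto simp: Basis_prod_def)

lemma grad_plane: "grad u p = (frechet_derivative u (at p) (1,0), frechet_derivative u (at p) (0,1))"
  for u :: "real \<times> real \<Rightarrow> real"
  by (simp add: grad_def Basis_plane)

lemma smooth_plane:
  fixes u :: "real \<times> real \<Rightarrow> real"
  assumes "smooth u"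
  shows "u differentiable (at p)"
    and "continuous_on UNIV (\<lambda>p. frechet_derivative u (at p) (1,0))"
    and "continuous_on UNIV (\<lambda>p. frechet_derivative u (at p) (0,1))"
    and "continuous_on UNIV u" and "continuous_on UNIV (grad u)"
proof -
  have "times_cont_diff (Suc 0) u" using assms by (simp only: smooth_def)
  then have 1: "u differentiable (at p)" for p
    unfolding times_cont_diff.simps by blast
  from \<open>times_cont_diff (Suc 0) u\<close>
  have 2: "continuous_on UNIV (\<lambda>p. frechet_derivative u (at p) (1,0))" "continuous_on UNIV (\<lambda>p. frechet_derivative u (at p) (0,1))"
    by (auto simp: Basis_plane)
  show "u differentiable (at p)" by (rule 1)
  show 3: "continuous_on UNIV (\<lambda>p. frechet_derivative u (at p) (1,0))"
    "continuous_on UNIV (\<lambda>p. frechet_derivative u (at p) (0,1))" by (rule 2)+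
  show "continuous_on UNIV (grad u)"
    unfolding grad_plane[abs_def] by (intro continuous_on_Pair 3)
  show "continuous_on UNIV u"
    using 1 by (intro differentiable_imp_continuous_on) (auto simp: differentiable_on_def)
qed

lemma continuous_l2_triangle:
  fixes f :: "real \<times> real \<Rightarrow> 'b::euclidean_space"
  assumes c: "continuous_on UNIV f" shows "f \<in> l2 (lebesgue_on (right_triangle h))"
proof -
  have "f \<in> borel_measurable lebesgue"
    using borel_measurable_continuous_onI[OF c] by (intro measurable_completion) simp
  then have "f \<in> borel_measurable (lebesgue_on (right_triangle h))" by (rule measurable_restrict_space1)
  moreover have "integrable (lebesgue_on (right_triangle h)) (\<lambda>x. (norm (f x))\<^sup>2)"
    by (intro triangle_integral continuous_intros c)
  ultimately show ?thesis by (simp add: l2_def)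
qed

text \<open>
  Subtracting from \<open>u\<close> its mean over the leg establishes the boundary condition without changing the
  gradient.
\<close>
lemma smooth_triangle_inequality:
  fixes u :: "real \<times> real \<Rightarrow> real"
  assumes h: "h > 0" and z: "0 < z" "z < pi" "z * cot z + 1 = 0" and z6: "z\<^sup>2 \<le> 6"
    and u: "smooth u"
  defines "a \<equiv> (LINT y|ival h. u (h, y)) / h"
  shows "l2_norm (lebesgue_on (right_triangle h)) (\<lambda>p. u p - a) \<le> inverse z * h * l2_norm (lebesgue_on (right_triangle h)) (grad u)"
proof -
  note s = smooth_plane[OF u]
  have fd: "frechet_derivative (\<lambda>p. u p - a) (at p) = frechet_derivative u (at p)" for p
  proof -
    have "(u has_derivative frechet_derivative u (at p)) (at p)" using s(1) by (simp add: frechet_derivative_works)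
    then have "((\<lambda>p. u p - a) has_derivative frechet_derivative u (at p)) (at p)"
      using has_derivative_diff[OF _ has_derivative_const, of u _ _ a] by simp
    then show ?thesis by (rule frechet_derivative_at[symmetric])
  qed
  have "continuous_on UNIV (\<lambda>y. u (h, y))" by (intro continuous_on_compose2[OF s(4)] continuous_intros) auto
  then have "bounded_borel h (\<lambda>y. u (h, y))" by (rule bounded_borel_cont)
  then have m: "(LINT y|ival h. u (h, y) - a) = 0"
    using h by (simp add: bounded_borel_integrable a_def)
  let ?T = "lebesgue_on (right_triangle h)"
  let ?D1 = "\<lambda>p. frechet_derivative u (at p) (1,0)" and ?D2 = "\<lambda>p. frechet_derivative u (at p) (0,1)"
  have "(z/h)\<^sup>2 * (LINT p|?T. (u p - a)\<^sup>2) \<le> (LINT p|?T. (?D1 p)\<^sup>2) + (LINT p|?T. (?D2 p)\<^sup>2)"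
    using triangle_inequality[of h z "\<lambda>p. u p - a", unfolded fd, OF h z z6 _ s(2) s(3) m] s(1) by (simp add: differentiable_diff)
  also have "\<dots> = (LINT p|?T. (?D1 p)\<^sup>2 + (?D2 p)\<^sup>2)"
    by (intro Bochner_Integration.integral_add[symmetric] triangle_integral continuous_intros s)
  also have "\<dots> = (LINT p|?T. (norm (grad u p))\<^sup>2)"
    by (simp add: grad_plane norm_Pair)
  finally have "(z/h)\<^sup>2 * (LINT p|?T. (u p - a)\<^sup>2) \<le> (LINT p|?T. (norm (grad u p))\<^sup>2)" .
  then have "sqrt ((z/h)\<^sup>2 * (LINT p|?T. (u p - a)\<^sup>2)) \<le> l2_norm ?T (grad u)"
    unfolding l2_norm_def by (rule real_sqrt_le_mono)
  then have "z/h * l2_norm ?T (\<lambda>p. u p - a) \<le> l2_norm ?T (grad u)"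
    using z h by (simp add: real_sqrt_mult l2_norm_def)
  then show ?thesis using z h by (simp add: field_simps)
qed


section \<open>Surface measure on a vertical segment\<close>

text \<open>
  A set of diameter \<open>d\<close> that meets the line projects into an interval of length \<open>d\<close>, so every admissible
  covering costs at least the Lebesgue measure.
\<close>
lemma hausdorff_pre_ge:
  fixes A :: "(real \<times> real) set"
  assumes A: "A \<in> sets borel" and sub: "A \<subseteq> {h} \<times> UNIV"
  shows "emeasure lborel (Pair h -` A) \<le> hausdorff_pre 1 \<delta> A"
  unfolding hausdorff_pre_def
proof (rule INF_greatest)
  fix U :: "nat \<Rightarrow> (real \<times> real) set"
  assume "U \<in> {U. A \<subseteq> (\<Union>i. U i) \<and> (\<forall>i. bounded (U i) \<and> diameter (U i) \<le> \<delta>)}"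
  then have cov: "A \<subseteq> (\<Union>i. U i)" and bd: "\<And>i. bounded (U i)" by auto
  define V where "V i = (if U i = {} then {} else {Inf (snd ` U i) .. Inf (snd ` U i) + diameter (U i)})" for i
  have UV: "snd ` U i \<subseteq> V i" for i
  proof (cases "U i = {}")
    case False
    have bb: "bdd_below (snd ` U i)" by (intro bounded_imp_bdd_below bounded_snd bd)
    have "y \<le> Inf (snd ` U i) + diameter (U i)" if "y \<in> snd ` U i" for y
    proof -
      have "y - diameter (U i) \<le> Inf (snd ` U i)"
      proof (rule cInf_greatest)
        fix y' assume "y' \<in> snd ` U i"
        then obtain p p' where p: "p \<in> U i" "p' \<in> U i" "y = snd p" "y' = snd p'" using \<open>y \<in> snd ` U i\<close> by blast
        have "y - y' \<le> dist p p'" using dist_snd_le[of p p'] p by (simp add: dist_real_def)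
        also have "\<dots> \<le> diameter (U i)" using p bd by (intro diameter_bounded_bound)
        finally show "y - diameter (U i) \<le> y'" by simp
      qed (use False in auto)
      then show ?thesis by simp
    qed
    moreover have "Inf (snd ` U i) \<le> y" if "y \<in> snd ` U i" for y
      using that bb by (rule cInf_lower)
    ultimately show ?thesis using False by (force simp: V_def)
  qed simp
  have "Pair h -` A \<subseteq> (\<Union>i. V i)"
  proof
    fix y assume "y \<in> Pair h -` A"
    then obtain i where "(h, y) \<in> U i" using cov by blast
    then have "y \<in> V i" using UV[of i] by force
    then show "y \<in> (\<Union>i. V i)" by blast
  qed
  then have "emeasure lborel (Pair h -` A) \<le> emeasure lborel (\<Union>i. V i)"
    by (intro emeasure_mono) (auto simp: V_def)
  also have "\<dots> \<le> (\<Sum>i. emeasure lborel (V i))"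
    by (intro emeasure_subadditive_countably) (auto simp: V_def)
  also have "\<dots> = (\<Sum>i. if U i = {} then 0 else ennreal (diameter (U i) ^ 1))"
    by (intro arg_cong[where f=suminf] ext) (auto simp: V_def diameter_ge_0 bd)
  finally show "emeasure lborel (Pair h -` A) \<le> \<dots>" .
qed

text \<open>
  Subdividing an interval does not change the total length, hence the bound \<open>\<delta>\<close> on the diameters
  does not increase the cost of a covering by intervals.
\<close>
lemma hausdorff_pre_le_intervals:
  fixes A :: "(real \<times> real) set"
  assumes cov: "A \<subseteq> {h} \<times> (\<Union>j. {u j..v j})" and uv: "\<And>j::nat. u j \<le> v j" and \<delta>: "\<delta> > 0"
  shows "hausdorff_pre 1 \<delta> A \<le> (\<Sum>j. ennreal (v j - u j))"
proof -
  \<comment> \<open>cut each interval in \<open>N j\<close> equal pieces of length at most \<open>\<delta>\<close>\<close>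
  define N where "N j = Suc (nat \<lceil>(v j - u j) / \<delta>\<rceil>)" for j
  define L where "L j = (v j - u j) / N j" for j
  have L0: "0 \<le> L j" for j using uv by (simp add: L_def N_def)
  have L\<delta>: "L j \<le> \<delta>" for j
  proof -
    have "(v j - u j) / \<delta> \<le> real (N j)" unfolding N_def by linarith
    then show ?thesis using \<delta> by (simp add: L_def N_def field_simps)
  qed
  define W where "W j i = (if i < N j then {h} \<times> {u j + i * L j .. u j + Suc i * L j} else {})" for j i
  define U where "U n = case_prod W (prod_decode n)" for n
  have W: "bounded (W j i)" "diameter (W j i) \<le> L j" for i j
  proof -
    show "bounded (W j i)" by (auto simp: W_def bounded_Times)
    show "diameter (W j i) \<le> L j"
      using L0[of j] by (auto simp: W_def dist_Pair_Pair dist_real_def algebra_simps intro!: diameter_le)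
  qed
  have covW: "y \<in> (\<Union>i. snd ` W j i)" if "y \<in> {u j..v j}" for y j
  proof (cases "L j = 0")
    case True
    then have "y = u j" using that by (auto simp: L_def N_def)
    then have "y \<in> snd ` W j 0" using True by (auto simp: W_def N_def)
    then show ?thesis by blast
  next
    case False
    then have Lp: "L j > 0" using L0[of j] by simp
    show ?thesis
    proof (cases "y = v j")
      case True
      have "N j * L j = v j - u j" by (simp add: L_def N_def)
      then have "y \<in> snd ` W j (N j - 1)" using True Lp
        by (auto simp: W_def N_def algebra_simps)
      then show ?thesis by blast
    next
      case ne: False
      define i where "i = nat \<lfloor>(y - u j) / L j\<rfloor>"
      have "0 \<le> (y - u j) / L j" using that Lp by simp
      then have i: "real i \<le> (y - u j) / L j" "(y - u j) / L j < real i + 1" unfolding i_def by linarith+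
      have "N j * L j = v j - u j" by (simp add: L_def N_def)
      then have "y - u j < N j * L j" using that ne by auto
      then have "(y - u j) / L j < N j" using Lp by (simp add: pos_divide_less_eq)
      then have "i < N j" using i by linarith
      moreover have "y \<in> {u j + i * L j .. u j + Suc i * L j}"
        using i Lp by (simp add: field_simps)
      ultimately have "y \<in> snd ` W j i" by (simp add: W_def)
      then show ?thesis by blast
    qed
  qed
  have fstW: "fst p = h" if "p \<in> W j i" for p j i using that by (auto simp: W_def split: if_splits)
  have "A \<subseteq> (\<Union>j i. W j i)"
  proof
    fix p assume "p \<in> A"
    then obtain j where p: "fst p = h" "snd p \<in> {u j..v j}" using cov by auto
    then obtain i p' where p': "p' \<in> W j i" "snd p = snd p'" using covW by blast
    then have "p = p'" using fstW p(1) by (simp add: prod_eq_iff)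
    then show "p \<in> (\<Union>j i. W j i)" using p' by blast
  qed
  also have "\<dots> \<subseteq> (\<Union>n. U n)"
  proof clarify
    fix a b j i assume "(a, b) \<in> W j i"
    then show "(a,b) \<in> (\<Union>n. U n)" by (intro UN_I[of "prod_encode (j,i)"]) (simp_all add: U_def)
  qed
  finally have AU: "A \<subseteq> (\<Union>n. U n)" .
  have "bounded (U n) \<and> diameter (U n) \<le> \<delta>" for n
    using W(1) order_trans[OF W(2) L\<delta>] by (simp add: U_def split: prod.split)
  with AU have "U \<in> {U. A \<subseteq> (\<Union>i. U i) \<and> (\<forall>i. bounded (U i) \<and> diameter (U i) \<le> \<delta>)}" by simp
  then have "hausdorff_pre 1 \<delta> A \<le> (\<Sum>i. if U i = {} then 0 else ennreal (diameter (U i) ^ 1))"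
    unfolding hausdorff_pre_def by (rule INF_lower[of U])
  also have "\<dots> \<le> (\<Sum>n. (\<lambda>(j,i). if i < N j then ennreal (L j) else 0) (prod_decode n))"
  proof (rule suminf_le)
    fix n
    obtain j i where ji: "prod_decode n = (j, i)" by fastforce
    have "(if W j i = {} then 0 else ennreal (diameter (W j i) ^ 1)) \<le> (if i < N j then ennreal (L j) else 0)"
    proof (cases "i < N j")
      case True
      then show ?thesis using ennreal_leI[OF W(2)[of j i]] by simp
    next
      case False
      then show ?thesis by (simp add: W_def)
    qed
    then show "(if U n = {} then 0 else ennreal (diameter (U n) ^ 1))
        \<le> (\<lambda>(j,i). if i < N j then ennreal (L j) else 0) (prod_decode n)"
      by (simp only: U_def ji prod.case)
  qed auto
  also have "\<dots> = (\<Sum>j. ennreal (v j - u j))"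
  proof (rule suminf_ennreal_2dimen)
    fix j
    have "(\<Sum>i. if i < N j then ennreal (L j) else 0) = (\<Sum>i<N j. ennreal (L j))"
      by (subst suminf_finite[of "{..<N j}"]) auto
    also have "\<dots> = ennreal (v j - u j)"
    proof -
      have "(\<Sum>i<N j. ennreal (L j)) = ennreal (\<Sum>i<N j. L j)" by (rule sum_ennreal) (rule L0)
      also have "(\<Sum>i<N j. L j) = v j - u j" by (simp add: L_def N_def)
      finally show ?thesis .
    qed
    finally show "ennreal (v j - u j) = (\<Sum>i. case (j, i) of (j, i) \<Rightarrow> if i < N j then ennreal (L j) else 0)" by simp
  qed
  finally show ?thesis .
qed

text \<open>
  Outer regularity of Lebesgue measure in terms of intervals with disjoint interiors, arranged in a
  sequence.
\<close>
lemma interval_cover: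
  fixes S :: "real set"
  assumes S: "S \<in> sets borel" "S \<subseteq> {0..h}" and e: "e > 0" and h: "h > 0"
  obtains u v :: "nat \<Rightarrow> real" where "S \<subseteq> (\<Union>j. {u j..v j})" "\<And>j. u j \<le> v j"
    "(\<Sum>j. ennreal (v j - u j)) \<le> emeasure lborel S + ennreal e"
proof -
  have Sl: "S \<in> lmeasurable" using S
    by (intro bounded_set_imp_lmeasurable) (auto intro: bounded_subset[OF bounded_closed_interval] )
  obtain \<D> where D: "countable \<D>" "\<And>K. K \<in> \<D> \<Longrightarrow> K \<subseteq> cbox 0 h \<and> K \<noteq> {} \<and> (\<exists>c d. K = cbox c d)"
    "pairwise (\<lambda>A B. interior A \<inter> interior B = {}) \<D>" "S \<subseteq> \<Union>\<D>" "\<Union>\<D> \<in> lmeasurable"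
    "measure lebesgue (\<Union>\<D>) \<le> measure lebesgue S + e"
    by (rule measurable_outer_intervals_bounded[OF Sl, of 0 h e]) (use S e in auto)
  obtain a b where ab: "K = {a K..b K} \<and> a K \<le> b K" if "K \<in> \<D>" for K
  proof -
    have "\<forall>K\<in>\<D>. \<exists>p. K = {fst p..snd p} \<and> fst p \<le> snd p" using D(2) by fastforce
    then obtain p where "\<forall>K\<in>\<D>. K = {fst (p K)..snd (p K)} \<and> fst (p K) \<le> snd (p K)" by metis
    then show ?thesis using that[of "fst \<circ> p" "snd \<circ> p"] by auto
  qed
  \<comment> \<open>indices outside the range of the enumeration get the degenerate interval at \<open>0\<close>\<close>
  define I where "I = to_nat_on \<D> ` \<D>"
  define u v where "u j = (if j \<in> I then a (from_nat_into \<D> j) else 0)"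
    and "v j = (if j \<in> I then b (from_nat_into \<D> j) else 0)" for j
  have fi: "from_nat_into \<D> j \<in> \<D>" "to_nat_on \<D> (from_nat_into \<D> j) = j" if "j \<in> I" for j
    using that D(1) by (auto simp: I_def)
  have "S \<subseteq> (\<Union>j. {u j..v j})"
  proof
    fix y assume "y \<in> S"
    then obtain K where K: "K \<in> \<D>" "y \<in> K" using D(4) by blast
    then have "y \<in> {u (to_nat_on \<D> K)..v (to_nat_on \<D> K)}"
      using ab[of K] D(1) by (auto simp: u_def v_def I_def)
    then show "y \<in> (\<Union>j. {u j..v j})" by blast
  qed
  moreover have uv: "u j \<le> v j" for j using ab[OF fi(1)[of j]] by (auto simp: u_def v_def)
  moreover have "(\<Sum>j. ennreal (v j - u j)) \<le> emeasure lborel S + ennreal e"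
  proof -
    have "disjoint_family (\<lambda>j. {u j<..<v j})"
      unfolding disjoint_family_on_def
    proof (intro ballI impI)
      fix i j :: nat assume "i \<noteq> j"
      show "{u i<..<v i} \<inter> {u j<..<v j} = {}"
      proof (cases "i \<in> I \<and> j \<in> I")
        case True
        then have "from_nat_into \<D> i \<noteq> from_nat_into \<D> j" using fi(2) \<open>i \<noteq> j\<close> by metis
        then have "interior (from_nat_into \<D> i) \<inter> interior (from_nat_into \<D> j) = {}"
          using D(3) fi(1) True by (auto simp: pairwise_def)
        then have "interior {u i..v i} \<inter> interior {u j..v j} = {}"
          using ab[OF fi(1)[of i]] ab[OF fi(1)[of j]] True by (simp add: u_def v_def)
        then show ?thesis by simp
      qed (auto simp: u_def v_def)
    qed
    then have "(\<Sum>j. emeasure lborel {u j<..<v j}) = emeasure lborel (\<Union>j. {u j<..<v j})"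
      by (intro suminf_emeasure) auto
    also have "\<dots> = emeasure lebesgue (\<Union>j. {u j<..<v j})" by simp
    also have "\<dots> \<le> emeasure lebesgue (\<Union>\<D>)"
    proof (rule emeasure_mono)
      show "(\<Union>j. {u j<..<v j}) \<subseteq> \<Union>\<D>"
      proof clarify
        fix y j assume y: "y \<in> {u j<..<v j}"
        have "j \<in> I" by (rule ccontr) (use y in \<open>simp add: u_def v_def\<close>)
        then have "from_nat_into \<D> j \<in> \<D>" "from_nat_into \<D> j = {u j..v j}"
          using fi(1) ab[OF fi(1)] by (simp_all add: u_def v_def)
        then show "y \<in> \<Union>\<D>" using y by (intro UnionI[of "from_nat_into \<D> j"]) auto
      qed
    qed (use D(5) in auto)
    also have "\<dots> = ennreal (measure lebesgue (\<Union>\<D>))" using D(5) by (simp add: emeasure_eq_measure2)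
    also have "\<dots> \<le> ennreal (measure lebesgue S + e)" using D(6) by (rule ennreal_leI)
    also have "\<dots> = ennreal (measure lebesgue S) + ennreal e" using e by simp
    also have "ennreal (measure lebesgue S) = emeasure lborel S"
      using emeasure_eq_measure2[OF Sl] S(1) by simp
    finally show ?thesis using uv by simp
  qed
  ultimately show ?thesis using that by blast
qed

lemma hausdorff_vertical:
  fixes A :: "(real \<times> real) set"
  assumes A: "A \<in> sets borel" and sub: "A \<subseteq> {h} \<times> {0..h}" and h: "h > 0"
  shows "hausdorff 1 A = emeasure lborel (Pair h -` A)"
proof -
  have meas: "Pair h -` A \<in> sets borel"
    using measurable_sets[of "Pair h" borel borel A] A by (simp add: borel_measurable_continuous_onI continuous_intros)
  have le: "hausdorff_pre 1 \<delta> A \<le> emeasure lborel (Pair h -` A)" if "\<delta> > 0" for \<delta>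
  proof (rule ennreal_le_epsilon)
    fix e :: real assume "e > 0"
    obtain u v where uv: "Pair h -` A \<subseteq> (\<Union>j. {u j..v j})" "\<And>j. u j \<le> v j"
      "(\<Sum>j. ennreal (v j - u j)) \<le> emeasure lborel (Pair h -` A) + ennreal e"
      using interval_cover[OF meas _ \<open>e > 0\<close> h] sub by blast
    have "A \<subseteq> {h} \<times> (\<Union>j. {u j..v j})" using sub uv(1) by auto
    from hausdorff_pre_le_intervals[OF this uv(2) that] uv(3)
    show "hausdorff_pre 1 \<delta> A \<le> emeasure lborel (Pair h -` A) + ennreal e" by (rule order_trans)
  qed
  have "(SUP \<delta>\<in>{0<..}. hausdorff_pre 1 \<delta> A) = emeasure lborel (Pair h -` A)"
  proof (rule antisym)
    show "(SUP \<delta>\<in>{0<..}. hausdorff_pre 1 \<delta> A) \<le> emeasure lborel (Pair h -` A)"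
      using le by (intro SUP_least) auto
    have "emeasure lborel (Pair h -` A) \<le> hausdorff_pre 1 1 A"
      using A sub by (intro hausdorff_pre_ge) auto
    also have "\<dots> \<le> (SUP \<delta>\<in>{0<..}. hausdorff_pre 1 \<delta> A)" by (intro SUP_upper) auto
    finally show "emeasure lborel (Pair h -` A) \<le> \<dots>" .
  qed
  then show ?thesis by (simp add: hausdorff_def unit_ball_vol_1)
qed

lemma measurable_Pair_leg:
  "Pair h \<in> measurable (restrict_space lborel {0..h}) (restrict_space borel ({h} \<times> {0..h}))"
proof (rule measurable_restrict_space3)
  have "Pair h \<in> measurable borel (borel \<Otimes>\<^sub>M borel)" by (rule measurable_Pair1') simp
  then show "Pair h \<in> borel_measurable lborel" by (simp add: borel_prod)
qed auto

text \<open>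
  A measure built from a set function that fails to be countably additive is zero by convention, so
  the values on Borel sets are compared with those of the image of Lebesgue measure, which is a measure.
\<close>
lemma surface_measure_vertical:
  fixes h :: real assumes h: "h > 0"
  shows "surface_measure ({h} \<times> {0..h}) =
    distr (restrict_space lborel {0..h}) (restrict_space borel ({h} \<times> {0..h})) (Pair h)"
    (is "surface_measure ?G = ?D")
proof -
  note m = measurable_Pair_leg[of h]
  have Gb: "?G \<in> sets borel" by (intro borel_closed closed_Times) auto
  have "surface_measure ?G = measure_of ?G (sets (restrict_space borel ?G)) (hausdorff 1)"
    by (simp add: surface_measure_def)
  also have "\<dots> = measure_of ?G (sets (restrict_space borel ?G)) (emeasure ?D)"
  proof (rule measure_of_eq)
    show "sets (restrict_space borel ?G) \<subseteq> Pow ?G" by (auto simp: sets_restrict_space)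
  next
    fix A assume "A \<in> sigma_sets ?G (sets (restrict_space borel ?G))"
    then have A': "A \<in> sets (restrict_space borel ?G)"
      using sets.sigma_sets_eq[of "restrict_space borel ?G"] by (simp add: space_restrict_space)
    then have A: "A \<in> sets borel" "A \<subseteq> ?G"
      using Gb by (auto simp: sets_restrict_space_iff)
    have "emeasure ?D A = emeasure (restrict_space lborel {0..h}) (Pair h -` A \<inter> {0..h})"
      using m A' by (simp add: emeasure_distr space_restrict_space)
    also have "Pair h -` A \<inter> {0..h} = Pair h -` A" using A by auto
    also have "emeasure (restrict_space lborel {0..h}) (Pair h -` A) = emeasure lborel (Pair h -` A)"
      using A by (intro emeasure_restrict_space) auto
    finally show "hausdorff 1 A = emeasure ?D A" using hausdorff_vertical[OF A h] by simp
  qed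
  also have "\<dots> = measure_of (space ?D) (sets ?D) (emeasure ?D)"
    by (simp add: space_restrict_space)
  also have "\<dots> = ?D" by (rule measure_of_of_measure)
  finally show ?thesis .
qed
abbreviation leg :: "real \<Rightarrow> (real \<times> real) set" where "leg h \<equiv> {h} \<times> {0..h}"

text \<open>
  The consequences of \<open>surface_measure_vertical\<close> that matter below. Omitting the two end points of the
  leg does not affect integrals.
\<close>
lemma surface_leg:
  fixes h :: real and f :: "real \<times> real \<Rightarrow> real"
  assumes h: "h > 0"
  shows "finite_measure (surface_measure (leg h))"
    and "measure (surface_measure (leg h)) (space (surface_measure (leg h))) = h"
    and "sets (surface_measure (leg h)) = sets (restrict_space borel (leg h))"
    and "continuous_on UNIV f \<Longrightarrow> (LINT x|surface_measure (leg h). f x) = (LINT y|ival h. f (h, y))"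
    and "continuous_on UNIV f \<Longrightarrow> f \<in> l2 (surface_measure (leg h))"
proof -
  let ?N = "restrict_space lborel {0..h}" and ?G = "restrict_space borel (leg h)"
  note m = measurable_Pair_leg[of h]
  note S = surface_measure_vertical[OF h]
  have N: "emeasure ?N (space ?N) = ennreal h" 
    using h emeasure_restrict_space[of "{0..h}" lborel "{0..h}"] by (simp add: space_restrict_space)
  have finN: "finite_measure ?N" by (rule finite_measureI) (simp only: N, simp)
  show fin: "finite_measure (surface_measure (leg h))"
    unfolding S by (rule finite_measure.finite_measure_distr[OF finN m])
  have "Pair h -` leg h \<inter> space ?N = space ?N" by (auto simp: space_restrict_space)
  then have "emeasure (surface_measure (leg h)) (space (surface_measure (leg h))) = ennreal h"
    unfolding S using m N by (simp add: emeasure_distr space_restrict_space sets_restrict_space_iff borel_closed closed_Times)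
  then show "measure (surface_measure (leg h)) (space (surface_measure (leg h))) = h"
    using h by (simp add: measure_def)
  show sets: "sets (surface_measure (leg h)) = sets ?G" unfolding S by simp
  have meas: "f \<in> borel_measurable (surface_measure (leg h))" if "continuous_on UNIV f" for f :: "real \<times> real \<Rightarrow> real"
    unfolding measurable_cong_sets[OF sets refl]
    by (intro measurable_restrict_space1 borel_measurable_continuous_onI that)
  show "(LINT x|surface_measure (leg h). f x) = (LINT y|ival h. f (h, y))" if c: "continuous_on UNIV f"
  proof -
    have "continuous_on UNIV (\<lambda>y. f (h, y))" by (intro continuous_on_compose2[OF c] continuous_intros) auto
    then have b: "(\<lambda>y. f (h, y)) \<in> borel_measurable borel" by (rule borel_measurable_continuous_onI)
    have "(LINT x|surface_measure (leg h). f x) = (LINT y|?N. f (h, y))"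
      unfolding S by (intro integral_distr m measurable_restrict_space1 borel_measurable_continuous_onI c)
    also have "\<dots> = (LINT y|lborel. indicator {0..h} y *\<^sub>R f (h, y))" by (rule integral_restrict_space) simp
    also have "\<dots> = (LINT y|lborel. indicator {0<..<h} y *\<^sub>R f (h, y))"
    proof (rule integral_cong_AE)
      show "AE y in lborel. indicator {0..h} y *\<^sub>R f (h, y) = indicator {0<..<h} y *\<^sub>R f (h, y)"
        using AE_lborel_singleton[of 0] AE_lborel_singleton[of h] by eventually_elim (auto simp: indicator_def)
    qed (use b in measurable)
    finally show ?thesis by (simp add: lborel_integral_ival)
  qed
  show "f \<in> l2 (surface_measure (leg h))" if c: "continuous_on UNIV f"
  proof -
    have "bounded (f ` leg h)"
      by (rule compact_imp_bounded[OF compact_continuous_image[OF continuous_on_subset[OF c]]]) (auto intro: compact_Times)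
    then obtain B where B: "\<And>p. p \<in> leg h \<Longrightarrow> norm (f p) \<le> B" unfolding bounded_iff by blast
    have sp: "space (surface_measure (leg h)) = leg h" unfolding S by (simp add: space_restrict_space)
    interpret finite_measure "surface_measure (leg h)" by (rule fin)
    have "integrable (surface_measure (leg h)) (\<lambda>x. (norm (f x))\<^sup>2)"
    proof (rule integrable_const_bound)
      show "AE x in surface_measure (leg h). norm ((norm (f x))\<^sup>2) \<le> B\<^sup>2"
      proof (rule AE_I2)
        fix x assume "x \<in> space (surface_measure (leg h))"
        then have "norm (f x) \<le> B" using B sp by blast
        then have "(norm (f x))\<^sup>2 \<le> B\<^sup>2" by (rule power_mono) simp
        then show "norm ((norm (f x))\<^sup>2) \<le> B\<^sup>2" by simp
      qed
      show "(\<lambda>x. (norm (f x))\<^sup>2) \<in> borel_measurable (surface_measure (leg h))"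
        by (intro meas continuous_intros c)
    qed
    then show ?thesis using meas[OF c] by (simp add: l2_def)
  qed
qed


section \<open>The upper bound\<close>

text \<open>
  If smooth functions \<open>u n\<close> approximate \<open>w\<close> in the sense of the trace, then their means \<open>a n\<close> over the leg
  tend to the mean of the trace, which is zero. So the inequality for \<open>u n - a n\<close> passes to the limit.
\<close>
lemma poincare_upper:
  assumes h: "h > 0" and z: "0 < z" "z < pi" "z * cot z + 1 = 0" and z6: "z\<^sup>2 \<le> 6"
  shows "poincare_const (right_triangle h) (leg h) (inverse z * h)"
  unfolding poincare_const_def
proof (intro allI impI)
  fix w dw
  assume "h1_mean_zero (right_triangle h) (leg h) w dw"
  then obtain \<tau> where w: "h1 (right_triangle h) w dw" and tr: "has_trace (right_triangle h) (leg h) w dw \<tau>"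
    and m0: "mean_value (surface_measure (leg h)) \<tau> = 0" unfolding h1_mean_zero_def by blast
  let ?T = "lebesgue_on (right_triangle h)" and ?S = "surface_measure (leg h)" and ?C = "inverse z * h"
  from tr obtain u where \<tau>: "\<tau> \<in> l2 ?S"
    and u: "\<And>n. smooth (u n)" "\<And>n. u n \<in> l2 ?T" "\<And>n. grad (u n) \<in> l2 ?T" "\<And>n. u n \<in> l2 ?S"
    and c0: "(\<lambda>n. l2_norm ?T (\<lambda>x. u n x - w x)) \<longlonglongrightarrow> 0"
    and c1: "(\<lambda>n. l2_norm ?T (\<lambda>x. grad (u n) x - dw x)) \<longlonglongrightarrow> 0"
    and cS: "(\<lambda>n. l2_norm ?S (\<lambda>x. u n x - \<tau> x)) \<longlonglongrightarrow> 0"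
    unfolding has_trace_def by blast
  have wl: "w \<in> l2 ?T" "dw \<in> l2 ?T" using w by (auto simp: h1_def)
  note fin = surface_leg(1)[OF h] and mS = surface_leg(2)[OF h]
  define a where "a n = (LINT y|ival h. u n (h, y)) / h" for n
  define K where "K = l2_norm ?T (\<lambda>_. 1::real)"
  have "a \<longlonglongrightarrow> 0"
  proof (rule tendsto_rabs_zero_cancel, rule tendsto_sandwich[of "\<lambda>_. 0"])
    show "\<forall>\<^sub>F n in sequentially. \<bar>a n\<bar> \<le> sqrt h * l2_norm ?S (\<lambda>x. u n x - \<tau> x) / h"
    proof (intro always_eventually allI)
      fix n
      have "(LINT x|?S. \<tau> x) = 0" using m0 h by (simp add: mean_value_def mS)
      then have "(LINT x|?S. u n x - \<tau> x) = (LINT x|?S. u n x)"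
        using l2_integral_le(1)[OF fin u(4)[of n]] l2_integral_le(1)[OF fin \<tau>] by simp
      also have "\<dots> = h * a n" using surface_leg(4)[OF h smooth_plane(4)[OF u(1)[of n]]] h by (simp add: a_def)
      finally have "\<bar>h * a n\<bar> \<le> sqrt h * l2_norm ?S (\<lambda>x. u n x - \<tau> x)"
        using l2_integral_le(2)[OF fin l2_diff[OF u(4)[of n] \<tau>]] by (simp add: mS)
      then show "\<bar>a n\<bar> \<le> sqrt h * l2_norm ?S (\<lambda>x. u n x - \<tau> x) / h"
        using h by (simp add: abs_mult field_simps)
    qed
    have "(\<lambda>n. sqrt h * l2_norm ?S (\<lambda>x. u n x - \<tau> x) / h) \<longlonglongrightarrow> sqrt h * 0 / h"
      using h by (intro tendsto_intros cS) auto
    then show "(\<lambda>n. sqrt h * l2_norm ?S (\<lambda>x. u n x - \<tau> x) / h) \<longlonglongrightarrow> 0" by simp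
  qed auto
  then have "(\<lambda>n. l2_norm ?T (\<lambda>x. u n x - w x) + \<bar>a n\<bar> * K + ?C * (l2_norm ?T (\<lambda>x. grad (u n) x - dw x) + l2_norm ?T dw))
     \<longlonglongrightarrow> 0 + \<bar>0\<bar> * K + ?C * (0 + l2_norm ?T dw)"
    by (intro tendsto_intros c0 c1)
  then have lim: "(\<lambda>n. l2_norm ?T (\<lambda>x. u n x - w x) + \<bar>a n\<bar> * K + ?C * (l2_norm ?T (\<lambda>x. grad (u n) x - dw x) + l2_norm ?T dw))
     \<longlonglongrightarrow> ?C * l2_norm ?T dw" by simp
  show "l2_norm ?T w \<le> ?C * l2_norm ?T dw"
  proof (rule LIMSEQ_le_const[OF lim], intro exI allI impI)
    fix n
    have cl: "(\<lambda>_. a n) \<in> l2 ?T" by (rule continuous_l2_triangle) (rule continuous_on_const)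
    have "l2_norm ?T w = l2_norm ?T (\<lambda>x. (w x - u n x) + u n x)" by simp
    also have "\<dots> \<le> l2_norm ?T (\<lambda>x. w x - u n x) + l2_norm ?T (u n)"
      by (rule l2_add(2)[OF l2_diff[OF wl(1) u(2)] u(2)])
    also have "l2_norm ?T (u n) = l2_norm ?T (\<lambda>x. a n + (u n x - a n))" by simp
    also have "\<dots> \<le> l2_norm ?T (\<lambda>x. a n) + l2_norm ?T (\<lambda>x. u n x - a n)"
      by (rule l2_add(2)[OF cl l2_diff[OF u(2) cl]])
    also have "l2_norm ?T (\<lambda>x. a n) = \<bar>a n\<bar> * K"
      unfolding K_def l2_norm_def by (simp add: real_sqrt_mult)
    also have "l2_norm ?T (\<lambda>x. u n x - a n) \<le> ?C * l2_norm ?T (grad (u n))"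
      unfolding a_def by (rule smooth_triangle_inequality[OF h z z6 u(1)])
    also have "l2_norm ?T (grad (u n)) = l2_norm ?T (\<lambda>x. (grad (u n) x - dw x) + dw x)" by simp
    also have "\<dots> \<le> l2_norm ?T (\<lambda>x. grad (u n) x - dw x) + l2_norm ?T dw"
      by (rule l2_add(2)[OF l2_diff[OF u(3) wl(2)] wl(2)])
    finally show "l2_norm ?T w \<le> l2_norm ?T (\<lambda>x. u n x - w x) + \<bar>a n\<bar> * K + ?C * (l2_norm ?T (\<lambda>x. grad (u n) x - dw x) + l2_norm ?T dw)"
      using z h by (simp add: l2_norm_commute[of _ w] mult_left_mono)
  qed
qed

section \<open>The extremal function\<close>

lemma cosine_sum_derivative:
  fixes k :: real
  defines "f \<equiv> \<lambda>a b \<alpha> \<beta> (p::real\<times>real). a * cos (k * fst p + \<alpha>) + b * cos (k * snd p + \<beta>)"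
  shows "(f a b \<alpha> \<beta> has_derivative (\<lambda>q. - a * k * sin (k * fst p + \<alpha>) * fst q - b * k * sin (k * snd p + \<beta>) * snd q)) (at p)"
proof -
  have 1: "((\<lambda>p. k * fst p + \<alpha>) has_derivative (\<lambda>q. k * fst q)) (at p)"
    "((\<lambda>p. k * snd p + \<beta>) has_derivative (\<lambda>q. k * snd q)) (at p)"
    by (auto intro!: derivative_eq_intros)
  have c: "((\<lambda>p. cos (g p)) has_derivative (\<lambda>q. - sin (g p) * g' q)) (at p)"
    if "(g has_derivative g') (at p)" for g :: "real \<times> real \<Rightarrow> real" and g'
    by (rule has_derivative_compose[OF that DERIV_cos[of "g p", unfolded has_field_derivative_def]])
  have "(f a b \<alpha> \<beta> has_derivative (\<lambda>q. a * (- sin (k * fst p + \<alpha>) * (k * fst q)) + b * (- sin (k * snd p + \<beta>) * (k * snd q)))) (at p)"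
    unfolding f_def by (intro has_derivative_add has_derivative_mult_right c 1)
  then show ?thesis by (simp add: algebra_simps)
qed

text \<open>
  The family is closed under partial derivatives because \<open>- sin x = cos (x + \<pi>/2)\<close>; this is why phases
  and amplitudes are kept as parameters.
\<close>
lemma cosine_sum_smooth:
  fixes k :: real
  shows "times_cont_diff n (\<lambda>p::real\<times>real. a * cos (k * fst p + \<alpha>) + b * cos (k * snd p + \<beta>))"
proof (induction n arbitrary: a b \<alpha> \<beta>)
  case 0
  show ?case by (simp, intro continuous_intros)
next
  case (Suc n)
  let ?f = "\<lambda>p::real\<times>real. a * cos (k * fst p + \<alpha>) + b * cos (k * snd p + \<beta>)"
  note D = cosine_sum_derivative[of a k \<alpha> b \<beta>]
  have fd: "frechet_derivative ?f (at p) = (\<lambda>q. - a * k * sin (k * fst p + \<alpha>) * fst q - b * k * sin (k * snd p + \<beta>) * snd q)" for p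
    using frechet_derivative_at[OF D[of p]] by simp
  have "?f differentiable (at p)" for p using D[of p] unfolding differentiable_def by blast
  moreover have "times_cont_diff n (\<lambda>p. frechet_derivative ?f (at p) (1,0))"
  proof -
    have "(\<lambda>p. frechet_derivative ?f (at p) (1,0)) = (\<lambda>p. (a * k) * cos (k * fst p + (\<alpha> + pi/2)) + 0 * cos (k * snd p + 0))"
      unfolding fd by (intro ext) (simp add: cos_add add.assoc[symmetric] cos_add[of "_ + _" "pi/2"])
    then show ?thesis by (simp only: Suc.IH)
  qed
  moreover have "times_cont_diff n (\<lambda>p. frechet_derivative ?f (at p) (0,1))"
  proof -
    have "(\<lambda>p. frechet_derivative ?f (at p) (0,1)) = (\<lambda>p. 0 * cos (k * fst p + 0) + (b * k) * cos (k * snd p + (\<beta> + pi/2)))"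
      unfolding fd by (intro ext) (simp add: add.assoc[symmetric] cos_add[of "_ + _" "pi/2"])
    then show ?thesis by (simp only: Suc.IH)
  qed
  ultimately show ?case by (simp add: Basis_plane)
qed

text \<open>
  Integration by parts, one variable at a time: the product \<open>u \<phi>\<close> vanishes on the boundary of the square
  and its derivative vanishes outside the triangle, so the integral of the derivative over the
  triangle equals that over the square and is zero on every line.
\<close>
lemma weak_gradient_smooth:
  fixes u :: "real \<times> real \<Rightarrow> real"
  assumes h: "h > 0" and u: "smooth u"
  shows "h1 (right_triangle h) u (grad u)"
  unfolding h1_def
proof (intro conjI allI impI)
  note su = smooth_plane[OF u]
  let ?T = "lebesgue_on (right_triangle h)"
  show "u \<in> l2 ?T" "grad u \<in> l2 ?T" using su by (auto intro: continuous_l2_triangle)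
  fix \<phi> assume \<phi>: "test_function (right_triangle h) \<phi>"
  then have "smooth \<phi>" by (simp add: test_function_def)
  note sp = smooth_plane[OF this]
  from \<phi> obtain K where K: "compact K" "K \<subseteq> right_triangle h" "\<And>p. p \<notin> K \<Longrightarrow> \<phi> p = 0"
    unfolding test_function_def by blast
  define D where "D f b p = frechet_derivative f (at p) b" for f :: "real \<times> real \<Rightarrow> real" and b p
  have D0: "D \<phi> b p = 0" if "p \<notin> K" for b p
  proof -
    have o: "open (- K)" using compact_imp_closed[OF K(1)] by (rule open_Compl)
    have "((\<lambda>_. 0) has_derivative (\<lambda>_. 0)) (at p)" by (rule has_derivative_const)
    then have "(\<phi> has_derivative (\<lambda>_. 0)) (at p)"
      by (rule has_derivative_transform_within_open[OF _ o]) (use that K(3) in auto)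
    then have "(\<lambda>_. 0) = frechet_derivative \<phi> (at p)" by (rule frechet_derivative_at)
    then show ?thesis unfolding D_def by metis
  qed
  have Dc: "continuous_on UNIV (D u (1,0))" "continuous_on UNIV (D u (0,1))"
    "continuous_on UNIV (D \<phi> (1,0))" "continuous_on UNIV (D \<phi> (0,1))"
    using su sp by (simp_all add: D_def[abs_def])
  define \<psi> where "\<psi> b p = D u b p * \<phi> p + D \<phi> b p * u p" for b p
  have \<psi>c: "continuous_on UNIV (\<psi> (1,0))" "continuous_on UNIV (\<psi> (0,1))"
    unfolding \<psi>_def[abs_def] by (intro continuous_intros Dc su sp)+
  have out: "\<phi> p = 0" "\<psi> b p = 0" if "p \<notin> right_triangle h" for p b
  proof -
    have "p \<notin> K" using that K(2) by blast
    from K(3)[OF this] D0[OF this] show "\<phi> p = 0" "\<psi> b p = 0" by (simp_all add: \<psi>_def)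
  qed
  have zero: "(LINT p|?T. \<psi> b p) = 0" if b: "b \<in> {(1,0), (0,1)}" for b
  proof -
    have c: "continuous_on UNIV (\<psi> b)" using b \<psi>c by auto
    have "(LINT p|?T. \<psi> b p) = (LINT x|ival h. LINT y|ival h. (if y < x then \<psi> b (x,y) else 0))"
      by (rule triangle_integral(2)[OF c])
    also have "\<dots> = (LINT x|ival h. LINT y|ival h. \<psi> b (x,y))"
      using out(2) by (intro Bochner_Integration.integral_cong refl) (auto simp: right_triangle_def)
    also have "\<dots> = 0"
    proof (cases "b = (0,1)")
      case True
      have "(LINT y|ival h. \<psi> b (x,y)) = 0" if x: "x \<in> {0..h}" for x
      proof -
        have "((\<lambda>y. \<psi> b (x,y)) has_integral (u (x,h) * \<phi> (x,h) - u (x,0) * \<phi> (x,0))) {0..h}"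
        proof (rule fundamental_theorem_of_calculus)
          fix y
          have "((\<lambda>y. u (x,y) * \<phi> (x,y)) has_real_derivative \<psi> b (x,y)) (at y)"
            unfolding True \<psi>_def D_def by (intro DERIV_mult partial_derivatives su sp)
          then show "((\<lambda>y. u (x,y) * \<phi> (x,y)) has_vector_derivative \<psi> b (x,y)) (at y within {0..h})"
            using has_field_derivative_at_within has_real_derivative_iff_has_vector_derivative by blast
        qed (use h in simp)
        moreover have "\<phi> (x,h) = 0" "\<phi> (x,0) = 0" by (rule out(1), simp add: right_triangle_def)+
        ultimately have "integral {0..h} (\<lambda>y. \<psi> b (x,y)) = 0" by (simp add: integral_unique)
        then show ?thesis using bounded_borel_integral_HK(1)[OF bounded_borel2_section1[OF bounded_borel2_cont[OF c] x]] by simp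
      qed
      then have "(LINT x|ival h. LINT y|ival h. \<psi> b (x,y)) = (LINT x|ival h. 0)"
        by (intro Bochner_Integration.integral_cong) auto
      then show ?thesis by simp
    next
      case False
      then have b1: "b = (1,0)" using b by simp
      have "(LINT x|ival h. \<psi> b (x,y)) = 0" if y: "y \<in> {0..h}" for y
      proof -
        have "((\<lambda>x. \<psi> b (x,y)) has_integral (u (h,y) * \<phi> (h,y) - u (0,y) * \<phi> (0,y))) {0..h}"
        proof (rule fundamental_theorem_of_calculus)
          fix x
          have "((\<lambda>x. u (x,y) * \<phi> (x,y)) has_real_derivative \<psi> b (x,y)) (at x)"
            unfolding b1 \<psi>_def D_def by (intro DERIV_mult partial_derivatives su sp)
          then show "((\<lambda>x. u (x,y) * \<phi> (x,y)) has_vector_derivative \<psi> b (x,y)) (at x within {0..h})"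
            using has_field_derivative_at_within has_real_derivative_iff_has_vector_derivative by blast
        qed (use h in simp)
        moreover have "\<phi> (h,y) = 0" "\<phi> (0,y) = 0" by (rule out(1), simp add: right_triangle_def)+
        ultimately have "integral {0..h} (\<lambda>x. \<psi> b (x,y)) = 0" by (simp add: integral_unique)
        then show ?thesis using bounded_borel_integral_HK(1)[OF bounded_borel2_section2[OF bounded_borel2_cont[OF c] y]] by simp
      qed
      then have "(LINT y|ival h. LINT x|ival h. \<psi> b (x,y)) = (LINT y|ival h. 0)"
        by (intro Bochner_Integration.integral_cong) auto
      then show ?thesis using bounded_borel_Fubini[OF bounded_borel2_cont[OF c]] by simp
    qed
    finally show ?thesis .
  qed
  have int: "integrable ?T f" if "continuous_on UNIV f" for f :: "real \<times> real \<Rightarrow> real \<times> real"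
  proof (rule Bochner_Integration.integrable_bound)
    show "integrable ?T (\<lambda>p. norm (f p))" by (intro triangle_integral continuous_intros that)
    show "f \<in> borel_measurable ?T" using continuous_l2_triangle[OF that] by (simp add: l2_def)
  qed simp
  have i1: "integrable ?T (\<lambda>p. u p *\<^sub>R grad \<phi> p)" and i2: "integrable ?T (\<lambda>p. \<phi> p *\<^sub>R grad u p)"
    by (intro int continuous_intros su sp)+
  have "(LINT p|?T. u p *\<^sub>R grad \<phi> p) + (LINT p|?T. \<phi> p *\<^sub>R grad u p) = (LINT p|?T. u p *\<^sub>R grad \<phi> p + \<phi> p *\<^sub>R grad u p)"
    using i1 i2 by simp
  also have "\<dots> = 0"
  proof (rule euclidean_eqI)
    fix b :: "real \<times> real" assume "b \<in> Basis"
    then have b: "b \<in> {(1,0), (0,1)}" by (simp add: Basis_plane)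
    have "(LINT p|?T. u p *\<^sub>R grad \<phi> p + \<phi> p *\<^sub>R grad u p) \<bullet> b = (LINT p|?T. (u p *\<^sub>R grad \<phi> p + \<phi> p *\<^sub>R grad u p) \<bullet> b)"
      using i1 i2 by (intro integral_inner_left[symmetric]) simp
    also have "\<dots> = (LINT p|?T. \<psi> b p)"
      using b by (intro Bochner_Integration.integral_cong) (auto simp: grad_plane \<psi>_def D_def)
    finally show "(LINT p|?T. u p *\<^sub>R grad \<phi> p + \<phi> p *\<^sub>R grad u p) \<bullet> b = 0 \<bullet> b" using zero[OF b] by simp
  qed
  finally show "(LINT p|?T. u p *\<^sub>R grad \<phi> p) = - (LINT p|?T. \<phi> p *\<^sub>R grad u p)"
    by (simp add: add_eq_0_iff2)
qed

text \<open>
  A smooth function is its own trace: the constant sequence approximates it.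
\<close>
lemma smooth_h1_mean_zero:
  fixes u :: "real \<times> real \<Rightarrow> real"
  assumes h: "h > 0" and u: "smooth u" and mean: "(LINT y|ival h. u (h, y)) = 0"
  shows "h1_mean_zero (right_triangle h) (leg h) u (grad u)"
proof -
  note su = smooth_plane[OF u]
  have l2: "u \<in> l2 (lebesgue_on (right_triangle h))" "grad u \<in> l2 (lebesgue_on (right_triangle h))" "u \<in> l2 (surface_measure (leg h))"
    by (intro continuous_l2_triangle surface_leg(5)[OF h] su)+
  have "has_trace (right_triangle h) (leg h) u (grad u) u"
    unfolding has_trace_def using weak_gradient_smooth[OF h u] l2 u
    by (auto intro!: exI[of _ "\<lambda>_. u"] simp: l2_norm_def)
  moreover have "mean_value (surface_measure (leg h)) u = 0"
    using surface_leg(4)[OF h su(4)] mean by (simp add: mean_value_def)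
  ultimately show ?thesis unfolding h1_mean_zero_def using weak_gradient_smooth[OF h u] by blast
qed

text \<open>
  Let \<open>w = cos (k x1) + cos (k x2)\<close>. Over the square, \<open>\<integral>\<integral> w\<^sup>2 = 2 h \<integral> cos\<^sup>2 + 2 (\<integral> cos)\<^sup>2\<close> while the
  Dirichlet integral is \<open>k\<^sup>2\<close> times \<open>2 h \<integral> sin\<^sup>2\<close>; the two double integrals agree precisely when \<open>z cos z = - sin z\<close>.
\<close>
lemma poincare_sharp:
  assumes h: "h > 0" and z: "0 < z" "z < pi" "z * cot z + 1 = 0"
    and C: "poincare_const (right_triangle h) (leg h) C"
  shows "inverse z * h \<le> C"
proof -
  define k where "k = z/h"
  have k: "k > 0" "k * h = z" using z h by (auto simp: k_def)
  define w where "w = (\<lambda>p::real\<times>real. 1 * cos (k * fst p + 0) + 1 * cos (k * snd p + 0))"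
  have wxy: "w (x,y) = cos (k*x) + cos (k*y)" for x y by (simp add: w_def)
  have sw: "smooth w" unfolding smooth_def w_def using cosine_sum_smooth by blast
  note s = smooth_plane[OF sw]
  have "frechet_derivative w (at p) = (\<lambda>q. - 1 * k * sin (k * fst p + 0) * fst q - 1 * k * sin (k * snd p + 0) * snd q)" for p
    unfolding w_def by (rule frechet_derivative_at[OF cosine_sum_derivative, symmetric])
  then have gw: "grad w p = (- k * sin (k * fst p), - k * sin (k * snd p))" for p
    by (simp add: grad_plane)
  have bcos: "bounded_borel h (\<lambda>x. cos (k*x))" and bsin: "bounded_borel h (\<lambda>x. sin (k*x))" by (intro bounded_borel_cont continuous_intros)+
  have sinz: "sin z > 0" using z by (intro sin_gt_zero)
  have zcos: "z * cos z = - sin z" using z(3) sinz by (simp add: cot_def field_simps)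
  define c2 where "c2 = (LINT x|ival h. (cos (k*x))\<^sup>2)"
  have c1: "(LINT x|ival h. cos (k*x)) = sin z / k"
  proof -
    have "((\<lambda>x. cos (k*x)) has_integral (sin (k*h)/k - sin (k*0)/k)) {0..h}"
      using h k by (intro fundamental_theorem_of_calculus)
        (auto intro!: derivative_eq_intros simp flip: has_real_derivative_iff_has_vector_derivative)
    then show ?thesis using bounded_borel_integral_HK(1)[OF bcos] k by (simp add: integral_unique)
  qed
  have c2v: "c2 = h/2 + sin z * cos z / (2*k)"
  proof -
    have "((\<lambda>x. (cos (k*x))\<^sup>2) has_integral ((h/2 + sin (k*h) * cos (k*h) / (2*k)) - (0/2 + sin (k*0) * cos (k*0) / (2*k)))) {0..h}"
    proof (rule fundamental_theorem_of_calculus)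
      fix x
      have "((\<lambda>x. x/2 + sin (k*x) * cos (k*x) / (2*k)) has_real_derivative
         (1/2 + ((cos (k*x) * k) * cos (k*x) + (- sin (k*x) * k) * sin (k*x)) / (2*k))) (at x within {0..h})"
        using k by (auto intro!: derivative_eq_intros simp: field_simps)
      also have "((cos (k*x) * k) * cos (k*x) + (- sin (k*x) * k) * sin (k*x)) / (2*k) = ((cos (k*x))\<^sup>2 - (sin (k*x))\<^sup>2) / 2"
        using k by (simp add: field_simps power2_eq_square)
      also have "1/2 + \<dots> = (cos (k*x))\<^sup>2"
        using sin_cos_squared_add[of "k*x"] by argo
      finally show "((\<lambda>x. x/2 + sin (k*x) * cos (k*x) / (2*k)) has_vector_derivative (cos (k*x))\<^sup>2) (at x within {0..h})"
        by (simp add: has_real_derivative_iff_has_vector_derivative)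
    qed (use h in simp)
    then show ?thesis unfolding c2_def using bounded_borel_integral_HK(1)[OF bounded_borel_power2[OF bcos]] k by (simp add: integral_unique)
  qed
  have s2: "(LINT x|ival h. (sin (k*x))\<^sup>2) = h - c2"
  proof -
    have "(LINT x|ival h. (sin (k*x))\<^sup>2) = (LINT x|ival h. 1 - (cos (k*x))\<^sup>2)" by (simp add: sin_squared_eq)
    then show ?thesis using h by (simp add: c2_def bounded_borel_integrable bounded_borel_power2 bcos)
  qed
  let ?T = "lebesgue_on (right_triangle h)"
  have W: "2 * (LINT p|?T. (w p)\<^sup>2) = 2 * h * c2 + 2 * (sin z / k)\<^sup>2"
  proof -
    have cw: "continuous_on UNIV (\<lambda>p. (w p)\<^sup>2)" by (intro continuous_intros s)
    have "2 * (LINT p|?T. (w p)\<^sup>2) = (LINT x|ival h. LINT y|ival h. (if y < x then (w (x,y))\<^sup>2 else (w (y,x))\<^sup>2))"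
      using reflect_integral[OF cw cw, of h] h by simp
    also have "\<dots> = (LINT x|ival h. LINT y|ival h. (cos (k*x))\<^sup>2 + 2 * cos (k*x) * cos (k*y) + (cos (k*y))\<^sup>2)"
      by (intro Bochner_Integration.integral_cong refl) (simp add: wxy power2_sum)
    also have "\<dots> = (LINT x|ival h. h * (cos (k*x))\<^sup>2 + 2 * cos (k*x) * (sin z / k) + c2)"
      using h by (simp add: bounded_borel_integrable bounded_borel_power2 bcos c1 c2_def)
    also have "\<dots> = h * c2 + 2 * (sin z / k) * (sin z / k) + h * c2"
      using h c1 by (simp add: bounded_borel_integrable bounded_borel_power2 bcos c2_def[symmetric])
    finally show ?thesis by (simp add: power2_eq_square)
  qed
  have G: "2 * (LINT p|?T. (norm (grad w p))\<^sup>2) = k\<^sup>2 * (2 * h * (h - c2))"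
  proof -
    have cg: "continuous_on UNIV (\<lambda>p. (norm (grad w p))\<^sup>2)" by (intro continuous_intros s)
    have "2 * (LINT p|?T. (norm (grad w p))\<^sup>2) = (LINT x|ival h. LINT y|ival h.
        (if y < x then (norm (grad w (x,y)))\<^sup>2 else (norm (grad w (y,x)))\<^sup>2))"
      using reflect_integral[OF cg cg, of h] h by simp
    also have "\<dots> = (LINT x|ival h. LINT y|ival h. k\<^sup>2 * (sin (k*x))\<^sup>2 + k\<^sup>2 * (sin (k*y))\<^sup>2)"
      by (intro Bochner_Integration.integral_cong refl) (simp add: gw norm_Pair power_mult_distrib)
    also have "\<dots> = (LINT x|ival h. h * (k\<^sup>2 * (sin (k*x))\<^sup>2) + k\<^sup>2 * (h - c2))"
      using h by (simp add: bounded_borel_integrable bounded_borel_power2 bsin s2)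
    also have "\<dots> = h * (k\<^sup>2 * (h - c2)) + h * (k\<^sup>2 * (h - c2))"
      using h by (simp add: bounded_borel_integrable bounded_borel_power2 bsin s2)
    finally show ?thesis by (simp add: algebra_simps)
  qed
  have key: "2 * h * (h - c2) = 2 * h * c2 + 2 * (sin z / k)\<^sup>2"
  proof -
    have "h * (h - 2 * c2) = - (h * cos z) * (sin z / k)" by (simp add: c2v field_simps)
    also have "- (h * cos z) = sin z / k" using zcos k h by (simp add: k_def field_simps)
    finally have "h * (h - 2 * c2) = (sin z / k)\<^sup>2" by (simp add: power2_eq_square)
    then show ?thesis by (simp only: right_diff_distrib)
  qed
  have pos: "(LINT p|?T. (w p)\<^sup>2) > 0"
  proof -
    have "0 \<le> c2" by (simp add: c2_def)
    moreover have "0 < (sin z / k)\<^sup>2" using sinz k by simp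
    ultimately show ?thesis using W h by (smt (verit) mult_nonneg_nonneg)
  qed
  have "(LINT p|?T. (norm (grad w p))\<^sup>2) = k\<^sup>2 * (LINT p|?T. (w p)\<^sup>2)"
    using G unfolding key W[symmetric] by simp
  then have eq: "l2_norm ?T (grad w) = k * l2_norm ?T w"
    using k by (simp add: l2_norm_def real_sqrt_mult)
  have "(LINT y|ival h. w (h, y)) = h * cos z + sin z / k"
    using h by (simp add: wxy k(2) bounded_borel_integrable bcos c1)
  also have "\<dots> = 0" using zcos k h by (simp add: k_def field_simps)
  finally have "(LINT y|ival h. w (h, y)) = 0" .
  then have "l2_norm ?T w \<le> C * l2_norm ?T (grad w)"
    using C smooth_h1_mean_zero[OF h sw] unfolding poincare_const_def by blast
  then have "1 * l2_norm ?T w \<le> (C * k) * l2_norm ?T w" by (simp add: eq)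
  moreover have "l2_norm ?T w > 0" using pos by (simp add: l2_norm_def)
  ultimately have "1 \<le> C * k" by (simp only: mult_le_cancel_right_pos)
  then show ?thesis using z h by (simp add: k_def field_simps)
qed

section \<open>The exact constant\<close>

theorem theorem3p1:
  fixes h :: real
  assumes "h > 0"
  shows "\<exists>z0 :: real.
    {z. 0 < z \<and> z < pi \<and> z * cot z + 1 = 0} = {z0} \<and>
    \<bar>z0 - 2.02876\<bar> \<le> 5 / 10 ^ 6 \<and>
    is_C1 {(x1 :: real, x2 :: real). 0 < x2 \<and> x2 < x1 \<and> x1 < h}
          {(x1 :: real, x2 :: real). x1 = h \<and> x2 \<in> {0..h}}
          (inverse z0 * h)"
proof -
  obtain z0 where z0: "{z. 0 < z \<and> z < pi \<and> z * cot z + 1 = 0} = {z0}"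
    and b: "2.028755 \<le> z0" "z0 \<le> 2.028765"
    using charfun_root by blast
  then have z: "0 < z0" "z0 < pi" "z0 * cot z0 + 1 = 0" by blast+
  have "z0\<^sup>2 \<le> 2.028765\<^sup>2" using b z by (intro power_mono) auto
  also have "\<dots> \<le> (6::real)" by (simp add: power2_eq_square)
  finally have z6: "z0\<^sup>2 \<le> 6" .
  have G: "{(x1 :: real, x2 :: real). x1 = h \<and> x2 \<in> {0..h}} = leg h" by auto
  have "is_C1 (right_triangle h) (leg h) (inverse z0 * h)"
    unfolding is_C1_def
    using poincare_upper[OF assms z z6] poincare_sharp[OF assms z] by blast
  moreover have "\<bar>z0 - 2.02876\<bar> \<le> 5 / 10 ^ 6" using b by (subst abs_le_iff) (simp add: field_simps)
  ultimately show ?thesis unfolding G right_triangle_def using z0 by blast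
qed

end
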